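(* For every fixed $t\in\mathbb{N}$ there is a constant $C_t\in\mathbb{R}$ (depending only on $t$) such that for every $d\ge 1$, every $d$-dimensional (combinatorial) cube equipped with an abstract (in particular: a generic linear) objective function, and every start vertex, the expected number of vertices visited by the Random-Edge simplex algorithm is at most $$C_t\cdot\frac{2^d}{d^t}.$$
   Context: A $d$-dimensional (combinatorial) cube is a polytope whose face lattice is isomorphic to that of $[0,1]^d$. Let $V$ be the vertex set of a polytope $P$. An acyclic unique sink orientation (AUSO) of $P$ is a directed graph $D=(V,A)$ such that (i) its underlying undirected graph is the vertex-edge graph of $P$, (ii) $D$ is acyclic, and (iii) for every nonempty face $F$ of $P$, the subgraph of $D$ induced by the vertices of $F$ has a unique sink. A function $\varphi:V\to\mathbb{R}$ is generic if $\varphi(v)\ne\varphi(w)$ whenever $v,w$ are adjacent; it induces the orientation with arc $v\to w$ for adjacent $v,w$ with $\varphi(v)>\varphi(w)$. An abstract objective function is a generic function $\varphi:V\to\mathbb{R}$ whose induced orientation is an AUSO (every generic linear function is one). The Random-Edge simplex algorithm started at a vertex $s$ performs the random walk on $D$ which, at each visited vertex other than the global sink $v_{\mathrm{opt}}$ of $D$, moves along an outgoing arc chosen uniformly at random (independently of the past) among all arcs leaving the current vertex, and stops at $v_{\mathrm{opt}}$. The number of visited vertices is the number of vertices on the resulting random directed path from $s$ to $v_{\mathrm{opt}}$ (both endpoints included). *)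

theory Defs
  imports "HOL-Probability.Probability" "HOL-Analysis.Finite_Function_Topology"
begin

text \<open>
  The constant of the theorem must not depend on the dimension, so all dimensions have to live in
  one type. The ambient space is \<^typ>\<open>nat \<Rightarrow>\<^sub>0 real\<close>, the real vector space of
  finitely supported sequences, i.e. the union of the spaces of real d-tuples for all d.
  Every polytope spans a finite-dimensional subspace, so this covers the polytopes of every
  Euclidean space up to affine isomorphism. The notions of polytopes below are the ones of
  HOL-Analysis that are available in arbitrary real vector spaces.
\<close>

definition unit_cube :: "nat \<Rightarrow> (nat \<Rightarrow>\<^sub>0 real) set" where
  "unit_cube d =
     {x. (\<forall>i<d. 0 \<le> Poly_Mapping.lookup x i \<and> Poly_Mapping.lookup x i \<le> 1) \<and>
         (\<forall>i\<ge>d. Poly_Mapping.lookup x i = 0)}"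

definition face_lattices_isomorphic :: "'a::real_vector set \<Rightarrow> 'b::real_vector set \<Rightarrow> bool" where
  "face_lattices_isomorphic P Q \<longleftrightarrow>
     (\<exists>f. bij_betw f {F. F face_of P} {G. G face_of Q} \<and>
          (\<forall>F F'. F face_of P \<longrightarrow> F' face_of P \<longrightarrow> (f F \<subseteq> f F' \<longleftrightarrow> F \<subseteq> F')))"

definition combinatorial_cube :: "nat \<Rightarrow> 'a::real_vector set \<Rightarrow> bool" where
  "combinatorial_cube d P \<longleftrightarrow> polytope P \<and> face_lattices_isomorphic P (unit_cube d)"

definition vertices :: "'a::real_vector set \<Rightarrow> 'a set" where
  "vertices P = {v. v extreme_point_of P}"

text \<open>
  The library's \<open>edge_of\<close> is restricted to Euclidean spaces. The edges of a polytope
  (its one-dimensional faces) are the non-degenerate segments that are faces.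
\<close>

definition adjacent :: "'a::real_vector set \<Rightarrow> 'a \<Rightarrow> 'a \<Rightarrow> bool" where
  "adjacent P v w \<longleftrightarrow>
     v \<in> vertices P \<and> w \<in> vertices P \<and> v \<noteq> w \<and> closed_segment v w face_of P"

text \<open>An arc from v to w is the pair \<open>(v, w)\<close>; the node set is always \<open>vertices P\<close>.\<close>

definition is_sink_on :: "('a \<times> 'a) set \<Rightarrow> 'a set \<Rightarrow> 'a \<Rightarrow> bool" where
  "is_sink_on A W v \<longleftrightarrow> v \<in> W \<and> (\<forall>w\<in>W. (v, w) \<notin> A)"

definition AUSO :: "'a::real_vector set \<Rightarrow> ('a \<times> 'a) set \<Rightarrow> bool" where
  "AUSO P A \<longleftrightarrow>
     (\<forall>v w. (v, w) \<in> A \<or> (w, v) \<in> A \<longleftrightarrow> adjacent P v w) \<and>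
     acyclic A \<and>
     (\<forall>F. F face_of P \<longrightarrow> F \<noteq> {} \<longrightarrow> (\<exists>!v. is_sink_on A (vertices F) v))"

definition generic :: "'a::real_vector set \<Rightarrow> ('a \<Rightarrow> real) \<Rightarrow> bool" where
  "generic P \<phi> \<longleftrightarrow> (\<forall>v w. adjacent P v w \<longrightarrow> \<phi> v \<noteq> \<phi> w)"

definition induced_orientation :: "'a::real_vector set \<Rightarrow> ('a \<Rightarrow> real) \<Rightarrow> ('a \<times> 'a) set" where
  "induced_orientation P \<phi> = {(v, w). adjacent P v w \<and> \<phi> v > \<phi> w}"

definition abstract_objective_function :: "'a::real_vector set \<Rightarrow> ('a \<Rightarrow> real) \<Rightarrow> bool" where
  "abstract_objective_function P \<phi> \<longleftrightarrow> generic P \<phi> \<and> AUSO P (induced_orientation P \<phi>)"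

text \<open>
  The distribution of the path visited by Random-Edge from \<open>v\<close>, as the list of its vertices.
  In an AUSO the only vertex without outgoing arcs is the global sink, so the walk stops exactly
  there. Mass missing from the subprobability distribution is the probability of not terminating;
  it is zero for finite acyclic \<open>A\<close> by \<open>lossless_random_edge\<close>.
\<close>

partial_function (spmf) random_edge :: "('a \<times> 'a) set \<Rightarrow> 'a \<Rightarrow> 'a list spmf" where
  "random_edge A v =
     (if A `` {v} = {} then return_spmf [v]
      else bind_spmf (spmf_of_set (A `` {v})) (\<lambda>w. map_spmf (\<lambda>p. v # p) (random_edge A w)))"

lemma lossless_random_edge:
  assumes "finite A" "acyclic A"
  shows "lossless_spmf (random_edge A v)"
proof (induction v rule: wf_induct_rule[OF finite_acyclic_wf_converse[OF assms]])
  case (1 v)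
  have fin: "finite (A `` {v})"
    using assms(1) by (rule finite_Image)
  have "lossless_spmf (random_edge A w)" if "w \<in> A `` {v}" for w
    using 1 that by blast
  then show ?case
    using fin by (subst random_edge.simps) (auto simp: set_spmf_of_set)
qed

definition expected_visited :: "('a \<times> 'a) set \<Rightarrow> 'a \<Rightarrow> ennreal" where
  "expected_visited A s = (\<integral>\<^sup>+p. of_nat (length p) \<partial>measure_spmf (random_edge A s))"

end

theory Submission
  imports Defs "HOL-Real_Asymp.Real_Asymp"
begin

text \<open>
  The idea is a potential argument. Let the vertices of the cube be the subsets \<open>X\<close> of
  \<open>{..<d}\<close>, and let \<open>avg f X\<close> be the mean of \<open>f\<close> over the out-neighbours of \<open>X\<close> (zero at the
  sink). Any \<open>U \<ge> 0\<close> with \<open>1 + avg U \<le> U\<close> bounds the expected number of visited vertices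
  (\<open>expected_visited_le_supersolution\<close>), so it suffices to construct such a \<open>U\<close> of size
  \<open>O(2 ^ d / d ^ t)\<close>.

  Order the vertices linearly by an injective rank with values below \<open>2 ^ d\<close> that decreases along
  all arcs. Call a vertex low if its outdegree is less than \<open>d / 4\<close>. Consider \<open>t\<close> consecutive steps
  of the walk from a vertex \<open>X\<close>, and suppose that no low vertex is met. Every step then chooses among
  at least \<open>d / 4\<close> directions, so for large \<open>d\<close> the walk most likely uses \<open>t\<close> distinct directions,
  and a given vertex at Hamming distance \<open>t\<close>, being reachable by only \<open>t!\<close> such paths, is
  hit with probability at most \<open>M = t! (4 / d) ^ t\<close> (\<open>path_weight_le\<close>, \<open>path_weight_mass\<close>). A random
  vertex that spread out cannot stay close to \<open>X\<close> in rank: with constant probability the rank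
  drops by at least a constant times \<open>1 / M\<close>, that is, by the order of \<open>d ^ t\<close> (\<open>rank_drop\<close>). Since
  the total drop is at most \<open>2 ^ d\<close>, only \<open>O(2 ^ d / d ^ t)\<close> such vertices are visited in
  expectation. A visited vertex of the other kind is likely to be followed by a low vertex within
  \<open>t\<close> steps, and since no vertex is visited twice, there are in expectation at most \<open>2 t\<close> times as
  many of these as there are low vertices.

  Low vertices are rare. For a set \<open>S\<close> of directions that are all incoming at \<open>X\<close>, the vertex
  \<open>X\<close> is the sink of the face through \<open>X\<close> with the directions \<open>S\<close>. As sinks of faces are unique and
  the cube has \<open>3 ^ d\<close> nonempty faces, the sum of \<open>2\<close> to the indegree over all vertices is at most
  \<open>3 ^ d\<close>; hence at most \<open>3 ^ d / 2 powr (3 * d / 4)\<close> vertices are low, which is exponentially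
  smaller than \<open>2 ^ d\<close> (\<open>card_low_vertices_le\<close>).

  The remaining work is to label the vertices of a combinatorial cube by subsets of \<open>{..<d}\<close>
  (\<open>combinatorial_cube_coordinates\<close>). The face lattice determines which sets of vertices span
  faces, because a face of a polytope is the convex hull of its vertices, and this information
  suffices to recover both the edges and the intervals of subsets that form faces.
\<close>

section \<open>Faces of polytopes in real vector spaces\<close>

lemma convex_Diff_face:
  assumes "convex C" "F face_of C" shows "convex (C - F)"
  unfolding convex_contains_segment
proof (intro ballI subsetI)
  fix a b x assume ab: "a \<in> C - F" "b \<in> C - F" and x: "x \<in> closed_segment a b"
  have "x \<in> C"
    using assms(1) ab x by (auto simp: convex_contains_segment)
  moreover have "x \<notin> F"
    using face_ofD[OF assms(2), of x a b] ab x by (auto simp: open_segment_def)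
  ultimately show "x \<in> C - F" by blast
qed

text \<open>
  The set consisting of \<open>convex hull (S \<inter> F)\<close> and of all points outside \<open>F\<close> is convex, as a segment
  with one endpoint outside the face \<open>F\<close> meets \<open>F\<close> at most in its other endpoint. It contains \<open>S\<close>, hence
  everything.
\<close>

lemma face_of_convex_hull_eq:
  assumes "F face_of convex hull S"
  shows "F = convex hull (S \<inter> F)"
proof
  let ?C = "convex hull S" and ?G = "convex hull (S \<inter> F)"
  have G: "?G \<subseteq> F"
    using face_of_imp_convex[OF assms] by (intro hull_minimal) auto
  have GC: "?G \<subseteq> ?C" by (intro hull_mono) auto
  have mixed: "closed_segment p q \<subseteq> ?G \<union> (?C - F)" if "p \<in> ?G" "q \<in> ?C - F" for p q
  proof
    fix x assume x: "x \<in> closed_segment p q"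
    have "closed_segment p q \<subseteq> ?C"
      using that GC by (intro closed_segment_subset convex_convex_hull) auto
    then have "x \<in> ?C" using x by blast
    moreover have "x \<notin> F" if "x \<in> open_segment p q"
      using face_ofD[OF assms that] \<open>p \<in> ?G\<close> \<open>q \<in> ?C - F\<close> GC by blast
    ultimately show "x \<in> ?G \<union> (?C - F)"
      using x that by (auto simp: open_segment_def)
  qed
  have "closed_segment a b \<subseteq> ?G \<union> (?C - F)"
    if ab: "a \<in> ?G \<union> (?C - F)" "b \<in> ?G \<union> (?C - F)" for a b
  proof -
    have "closed_segment a b \<subseteq> ?G" if "a \<in> ?G" "b \<in> ?G"
      using that by (intro closed_segment_subset convex_convex_hull)
    moreover have "closed_segment a b \<subseteq> ?C - F" if "a \<in> ?C - F" "b \<in> ?C - F"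
      using that convex_Diff_face[OF convex_convex_hull assms] by (intro closed_segment_subset)
    ultimately show ?thesis
      using ab mixed[of a b] mixed[of b a] closed_segment_commute[of b a] by blast
  qed
  then have "convex (?G \<union> (?C - F))"
    unfolding convex_contains_segment by blast
  moreover have "S \<subseteq> ?G \<union> (?C - F)"
    by (auto simp: hull_inc)
  ultimately have "?C \<subseteq> ?G \<union> (?C - F)"
    by (intro hull_minimal) auto
  then show "F \<subseteq> ?G"
    using face_of_imp_subset[OF assms] by blast
  show "?G \<subseteq> F" by (fact G)
qed

lemma finite_vertices: "polytope P \<Longrightarrow> finite (vertices P)"
  unfolding polytope_def vertices_def
  by (metis extreme_points_of_convex_hull finite_subset)

lemma vertices_subset: "vertices P \<subseteq> P"
  by (auto simp: vertices_def extreme_point_of_def)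

text \<open>
  The theorem of Krein and Milman for polytopes in an arbitrary real vector space: a generating
  set of least cardinality consists of extreme points.
\<close>

lemma polytope_eq_convex_hull_vertices:
  assumes "polytope P"
  shows "P = convex hull vertices P"
proof -
  obtain S where S: "finite S" "P = convex hull S"
    using assms by (auto simp: polytope_def)
  define T where "T = arg_min card (\<lambda>T. T \<subseteq> S \<and> convex hull T = P)"
  have T: "T \<subseteq> S" "convex hull T = P" and least: "\<And>R. R \<subseteq> S \<Longrightarrow> convex hull R = P \<Longrightarrow> card T \<le> card R"
    using arg_min_nat_lemma[of "\<lambda>T. T \<subseteq> S \<and> convex hull T = P" S card] S
    by (auto simp: T_def)
  have fin: "finite T" using T(1) S(1) by (rule finite_subset)
  have "x extreme_point_of P" if x: "x \<in> T" for x
  proof -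
    have "x \<notin> convex hull (T - {x})"
    proof
      assume "x \<in> convex hull (T - {x})"
      then have "convex hull (T - {x}) = P"
        using hull_redundant[of x convex "T - {x}"] x T(2) by (simp add: insert_absorb)
      then have "card T \<le> card (T - {x})"
        using least[of "T - {x}"] T(1) by blast
      then show False
        using card_Diff1_less[OF fin x] by simp
    qed
    then have "x extreme_point_of convex hull insert x (T - {x})"
      using fin by (intro extreme_point_of_convex_hull_insert) auto
    then show ?thesis
      using x T(2) by (simp add: insert_absorb)
  qed
  then have "T \<subseteq> vertices P" by (auto simp: vertices_def)
  then have "P \<subseteq> convex hull vertices P"
    using T(2) hull_mono by blast
  moreover have "convex hull vertices P \<subseteq> P"
    using vertices_subset polytope_imp_convex[OF assms] by (rule hull_minimal)
  ultimately show ?thesis by blast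
qed

lemma vertices_face:
  assumes "F face_of P"
  shows "vertices F = vertices P \<inter> F"
  using extreme_point_of_face[OF assms] by (auto simp: vertices_def)

lemma polytope_face_eq_convex_hull_vertices:
  assumes "polytope P" "F face_of P"
  shows "F = convex hull vertices F"
  using face_of_convex_hull_eq[of F "vertices P"] polytope_eq_convex_hull_vertices[OF assms(1)]
    assms(2) vertices_face[OF assms(2)] by simp

lemma vertices_face_empty_iff:
  assumes "polytope P" "F face_of P"
  shows "vertices F = {} \<longleftrightarrow> F = {}"
  using polytope_face_eq_convex_hull_vertices[OF assms] vertices_subset[of F] by auto

lemma vertices_iff_face: "v \<in> vertices P \<longleftrightarrow> {v} face_of P"
  by (simp add: vertices_def face_of_singleton)

text \<open>
  Vertices and edges are recognised from the inclusion order of faces, so that a lattice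
  isomorphism transports them: the next two lemmas are the order-theoretic descriptions.
\<close>

lemma singleton_face_iff_minimal:
  assumes "polytope P" "F face_of P"
  shows "(\<exists>v\<in>vertices P. F = {v}) \<longleftrightarrow>
    F \<noteq> {} \<and> (\<forall>G. G face_of P \<longrightarrow> G \<subseteq> F \<longrightarrow> G = {} \<or> G = F)"
proof
  assume r: "F \<noteq> {} \<and> (\<forall>G. G face_of P \<longrightarrow> G \<subseteq> F \<longrightarrow> G = {} \<or> G = F)"
  then obtain v where "v \<in> vertices F"
    using vertices_face_empty_iff[OF assms] by blast
  then have v: "v \<in> vertices P" "v \<in> F" using vertices_face[OF assms(2)] by auto
  then have "{v} = F" using r vertices_iff_face[of v P] by blast
  then show "\<exists>v\<in>vertices P. F = {v}" using v by blast
qed auto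

lemma adjacent_iff_face_with_two_vertices:
  assumes "polytope P"
  shows "adjacent P v w \<longleftrightarrow> v \<noteq> w \<and> (\<exists>F. F face_of P \<and> vertices F = {v, w})"
proof
  assume a: "adjacent P v w"
  then have F: "closed_segment v w face_of P" "v \<noteq> w" by (auto simp: adjacent_def)
  have "vertices (closed_segment v w) \<subseteq> {v, w}"
    using extreme_points_of_convex_hull[of "{v, w}"]
    by (simp add: vertices_def segment_convex_hull)
  moreover have "{v, w} \<subseteq> vertices (closed_segment v w)"
    using a vertices_face[OF F(1)] by (auto simp: adjacent_def)
  ultimately show "v \<noteq> w \<and> (\<exists>F. F face_of P \<and> vertices F = {v, w})"
    using F by blast
next
  assume "v \<noteq> w \<and> (\<exists>F. F face_of P \<and> vertices F = {v, w})"
  then obtain F where F: "v \<noteq> w" "F face_of P" "vertices F = {v, w}" by blast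
  have "F = closed_segment v w"
    using polytope_face_eq_convex_hull_vertices[OF assms F(2)] F(3)
    by (simp add: segment_convex_hull)
  then show "adjacent P v w"
    using F vertices_face[OF F(2)] by (auto simp: adjacent_def)
qed

lemma face_lattice_iso_vertices:
  assumes P: "polytope P" and Q: "polytope Q" and iso: "face_lattices_isomorphic P Q"
  obtains f \<pi> where
    "bij_betw f {F. F face_of P} {G. G face_of Q}"
    "bij_betw \<pi> (vertices P) (vertices Q)"
    "\<And>F. F face_of P \<Longrightarrow> vertices (f F) = \<pi> ` vertices F"
proof -
  obtain f where f: "bij_betw f {F. F face_of P} {G. G face_of Q}"
    and mono: "\<And>F F'. F face_of P \<Longrightarrow> F' face_of P \<Longrightarrow> f F \<subseteq> f F' \<longleftrightarrow> F \<subseteq> F'"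
    using iso by (auto simp: face_lattices_isomorphic_def)
  have fface: "f F face_of Q" if "F face_of P" for F
    using f that by (auto simp: bij_betw_def)
  have fsurj: "\<exists>F. F face_of P \<and> f F = G" if "G face_of Q" for G
  proof -
    have "G \<in> f ` {F. F face_of P}" using bij_betw_imp_surj_on[OF f] that by simp
    then show ?thesis by auto
  qed
  have finj: "f F = f F' \<longleftrightarrow> F = F'" if "F face_of P" "F' face_of P" for F F'
    using mono[OF that] mono[OF that(2,1)] by blast
  have fempty: "f F = {} \<longleftrightarrow> F = {}" if F: "F face_of P" for F
  proof -
    obtain E where E: "E face_of P" "f E = {}" using fsurj[of "{}"] by auto
    then have "E = {}" using mono[of E "{}"] by simp
    then show ?thesis using finj[OF F E(1)] E by simp
  qed
  have vert: "(\<exists>w\<in>vertices Q. f F = {w}) \<longleftrightarrow> (\<exists>v\<in>vertices P. F = {v})" if F: "F face_of P" for F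
  proof -
    have "(\<forall>G. G face_of Q \<longrightarrow> G \<subseteq> f F \<longrightarrow> G = {} \<or> G = f F) \<longleftrightarrow>
        (\<forall>H. H face_of P \<longrightarrow> f H \<subseteq> f F \<longrightarrow> f H = {} \<or> f H = f F)"
      using fface fsurj by metis
    also have "\<dots> \<longleftrightarrow> (\<forall>H. H face_of P \<longrightarrow> H \<subseteq> F \<longrightarrow> H = {} \<or> H = F)"
      using mono finj fempty F by simp
    finally show ?thesis
      using singleton_face_iff_minimal[OF P F] singleton_face_iff_minimal[OF Q fface[OF F]]
        fempty[OF F] by simp
  qed
  define \<pi> where "\<pi> v = (THE w. f {v} = {w})" for v
  have \<pi>: "f {v} = {\<pi> v}" "\<pi> v \<in> vertices Q" if v: "v \<in> vertices P" for v
  proof -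
    obtain w where w: "w \<in> vertices Q" "f {v} = {w}"
      using vert[of "{v}"] v vertices_iff_face[of v P] by auto
    then have "\<pi> v = w" by (simp add: \<pi>_def)
    then show "f {v} = {\<pi> v}" "\<pi> v \<in> vertices Q" using w by auto
  qed
  have \<pi>surj: "\<exists>v\<in>vertices P. \<pi> v = w" if w: "w \<in> vertices Q" for w
  proof -
    obtain F where F: "F face_of P" "f F = {w}"
      using fsurj w vertices_iff_face[of w Q] by blast
    then obtain v where "v \<in> vertices P" "F = {v}" using vert w by blast
    then show ?thesis using \<pi>[of v] F by auto
  qed
  have "bij_betw \<pi> (vertices P) (vertices Q)"
    unfolding bij_betw_def
  proof
    show "inj_on \<pi> (vertices P)"
      using \<pi>(1) finj by (intro inj_onI) (metis singleton_inject vertices_iff_face)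
    show "\<pi> ` vertices P = vertices Q"
      using \<pi>surj \<pi>(2) by blast
  qed
  moreover have "vertices (f F) = \<pi> ` vertices F" if F: "F face_of P" for F
  proof -
    have "\<pi> v \<in> f F \<longleftrightarrow> v \<in> F" if v: "v \<in> vertices P" for v
      using mono[of "{v}" F] F \<pi>(1)[OF v] v by (simp add: vertices_iff_face)
    moreover have "vertices Q = \<pi> ` vertices P" using \<pi>surj \<pi>(2) by blast
    ultimately show ?thesis
      using vertices_face[OF F] vertices_face[OF fface[OF F]] by auto
  qed
  ultimately show ?thesis using that f by blast
qed

section \<open>Coordinates on combinatorial cubes\<close>

definition flip :: "'a set \<Rightarrow> 'a set \<Rightarrow> 'a set" where
  "flip X S = sym_diff X S"

lemma mem_flip [simp]: "x \<in> flip X S \<longleftrightarrow> (x \<in> X) \<noteq> (x \<in> S)"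
  by (auto simp: flip_def)

lemma flip_empty [simp]: "flip X {} = X"
  by auto

lemma flip_subset: "X \<subseteq> D \<Longrightarrow> S \<subseteq> D \<Longrightarrow> flip X S \<subseteq> D"
  by (auto simp: flip_def)

lemma flip_flip [simp]: "flip X (flip X S) = S"
  by auto

lemma flip_insert: "i \<notin> S \<Longrightarrow> flip X (insert i S) = flip (flip X S) {i}"
  by auto

definition corner :: "nat set \<Rightarrow> (nat \<Rightarrow>\<^sub>0 real)" where
  "corner X = (\<Sum>i\<in>X. Poly_Mapping.single i 1)"

lemma lookup_corner: "finite X \<Longrightarrow> Poly_Mapping.lookup (corner X) i = (if i \<in> X then 1 else 0)"
  by (simp add: corner_def lookup_sum lookup_single when_def)

lemma corner_inject: "finite X \<Longrightarrow> finite Y \<Longrightarrow> corner X = corner Y \<longleftrightarrow> X = Y"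
proof
  assume fin: "finite X" "finite Y" and eq: "corner X = corner Y"
  have "i \<in> X \<longleftrightarrow> i \<in> Y" for i
    using lookup_corner[OF fin(1), of i] lookup_corner[OF fin(2), of i] eq
    by (simp split: if_splits)
  then show "X = Y" by blast
qed simp

lemma lookup_scaleR [simp]: "Poly_Mapping.lookup (c *\<^sub>R x) i = c *\<^sub>R Poly_Mapping.lookup x i"
  for x :: "'a \<Rightarrow>\<^sub>0 'b::real_vector"
  by (simp add: scaleR_poly_mapping_def)

lemma open_segment_coordinate:
  fixes x :: "nat \<Rightarrow>\<^sub>0 real"
  assumes "x \<in> open_segment a b"
  obtains u where "0 < u" "u < 1"
    "\<And>i. Poly_Mapping.lookup x i = (1 - u) * Poly_Mapping.lookup a i + u * Poly_Mapping.lookup b i"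
  using assms by (auto simp: in_segment lookup_add)

lemma convex_unit_cube_slice:
  "convex {x \<in> unit_cube d. (\<forall>i\<in>I. Poly_Mapping.lookup x i = 1) \<and> (\<forall>i\<in>K. Poly_Mapping.lookup x i = 0)}"
  unfolding convex_def unit_cube_def
  by (auto simp: lookup_add intro: convex_bound_le)

text \<open>The convex hull of the corners indexed by the interval from \<open>I\<close> to \<open>J\<close>.\<close>

definition interval_face :: "nat \<Rightarrow> nat set \<Rightarrow> nat set \<Rightarrow> (nat \<Rightarrow>\<^sub>0 real) set" where
  "interval_face d I J = {x \<in> unit_cube d.
     (\<forall>i\<in>I. Poly_Mapping.lookup x i = 1) \<and> (\<forall>i\<in>{..<d} - J. Poly_Mapping.lookup x i = 0)}"

text \<open>The endpoints 0 and 1 are faces of the unit interval; this makes interval faces faces.\<close>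

lemma convex_average_eq_endpoint:
  fixes a b u :: real
  assumes "0 < u" "u < 1" "0 \<le> a" "a \<le> 1" "0 \<le> b" "b \<le> 1"
  shows "(1 - u) * a + u * b = 0 \<longleftrightarrow> a = 0 \<and> b = 0" "(1 - u) * a + u * b = 1 \<longleftrightarrow> a = 1 \<and> b = 1"
proof -
  have 0: "(1 - u) * a + u * b = 0 \<longleftrightarrow> a = 0 \<and> b = 0"
    if "0 \<le> a" "0 \<le> b" for a b
    using that assms by (subst add_nonneg_eq_0_iff) auto
  show "(1 - u) * a + u * b = 0 \<longleftrightarrow> a = 0 \<and> b = 0" using 0 assms by blast
  have "(1 - u) * a + u * b = 1 \<longleftrightarrow> (1 - u) * (1 - a) + u * (1 - b) = 0"
    by (simp add: algebra_simps) linarith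
  then show "(1 - u) * a + u * b = 1 \<longleftrightarrow> a = 1 \<and> b = 1"
    using 0[of "1 - a" "1 - b"] assms by simp
qed

lemma interval_face_is_face:
  assumes "I \<subseteq> {..<d}"
  shows "interval_face d I J face_of unit_cube d"
  unfolding face_of_def
proof (intro conjI ballI impI)
  show "interval_face d I J \<subseteq> unit_cube d" by (auto simp: interval_face_def)
  show "convex (interval_face d I J)"
    unfolding interval_face_def by (rule convex_unit_cube_slice)
  fix a b x assume a: "a \<in> unit_cube d" and b: "b \<in> unit_cube d" and x: "x \<in> interval_face d I J"
    and seg: "x \<in> open_segment a b"
  obtain u where u: "0 < u" "u < 1"
    "\<And>i. Poly_Mapping.lookup x i = (1 - u) * Poly_Mapping.lookup a i + u * Poly_Mapping.lookup b i"
    using open_segment_coordinate[OF seg] by metis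
  have *: "(Poly_Mapping.lookup x i = 0 \<longleftrightarrow> Poly_Mapping.lookup a i = 0 \<and> Poly_Mapping.lookup b i = 0) \<and>
      (Poly_Mapping.lookup x i = 1 \<longleftrightarrow> Poly_Mapping.lookup a i = 1 \<and> Poly_Mapping.lookup b i = 1)"
    if "i < d" for i
    using convex_average_eq_endpoint[OF u(1,2), of "Poly_Mapping.lookup a i" "Poly_Mapping.lookup b i"]
      a b that by (simp add: u(3) unit_cube_def)
  show "a \<in> interval_face d I J" "b \<in> interval_face d I J"
    using a b x * assms by (auto simp: interval_face_def)
qed

lemma corner_in_unit_cube: "X \<subseteq> {..<d} \<Longrightarrow> corner X \<in> unit_cube d"
  using finite_subset[of X "{..<d}"] by (auto simp: unit_cube_def lookup_corner)

lemma corner_in_interval_face_iff: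
  assumes "X \<subseteq> {..<d}" "I \<subseteq> {..<d}"
  shows "corner X \<in> interval_face d I J \<longleftrightarrow> I \<subseteq> X \<and> X \<subseteq> J"
  using assms finite_subset[of X "{..<d}"] corner_in_unit_cube[OF assms(1)]
  by (auto simp: interval_face_def lookup_corner split: if_splits)

text \<open>
  By induction on the dimension: a point of the next cube lies on the segment that joins its
  projections to the facets where the last coordinate is 0 and 1.
\<close>

lemma unit_cube_eq_convex_hull_corners: "unit_cube d = convex hull (corner ` Pow {..<d})"
proof
  show "unit_cube d \<subseteq> convex hull (corner ` Pow {..<d})"
  proof (induction d)
    case 0
    have "x = corner {}" if "x \<in> unit_cube 0" for x
      using that by (intro poly_mapping_eqI) (auto simp: unit_cube_def lookup_corner)
    then show ?case by auto
  next
    case (Suc d)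
    show ?case
    proof
      fix x assume x: "x \<in> unit_cube (Suc d)"
      let ?c = "Poly_Mapping.lookup x d" and ?e = "Poly_Mapping.single d (1::real)"
      let ?H = "convex hull (corner ` Pow {..<Suc d})"
      define y where "y = x - Poly_Mapping.single d ?c"
      have "y \<in> unit_cube d"
        using x by (auto simp: unit_cube_def y_def lookup_minus lookup_single when_def)
      then have y: "y \<in> convex hull (corner ` Pow {..<d})" using Suc by blast
      have "corner ` Pow {..<d} \<subseteq> corner ` Pow {..<Suc d}"
        by (intro image_mono Pow_mono) auto
      then have y1: "y \<in> ?H"
        using y hull_mono by blast
      have "(+) ?e ` corner ` Pow {..<d} \<subseteq> corner ` Pow {..<Suc d}"
      proof clarify
        fix X assume X: "X \<subseteq> {..<d}"
        then have "?e + corner X = corner (insert d X)"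
          using finite_subset[OF X] by (subst corner_def, subst sum.insert) (auto simp: corner_def)
        then show "?e + corner X \<in> corner ` Pow {..<Suc d}" using X by fastforce
      qed
      moreover have "?e + y \<in> convex hull ((+) ?e ` corner ` Pow {..<d})"
        using y by (simp add: convex_hull_translation)
      ultimately have y2: "?e + y \<in> ?H"
        using hull_mono by blast
      have "x = (1 - ?c) *\<^sub>R y + ?c *\<^sub>R (?e + y)"
        by (intro poly_mapping_eqI)
          (simp add: y_def lookup_add lookup_minus lookup_single when_def algebra_simps)
      moreover have "0 \<le> ?c" "?c \<le> 1" using x by (auto simp: unit_cube_def)
      ultimately show "x \<in> ?H"
        using convexD_alt[OF convex_convex_hull y1 y2, of ?c] by simp
    qed
  qed
  have "convex (unit_cube d)"
    using convex_unit_cube_slice[of d "{}" "{}"] by simp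
  then show "convex hull (corner ` Pow {..<d}) \<subseteq> unit_cube d"
    using corner_in_unit_cube by (intro hull_minimal) auto
qed

lemma polytope_unit_cube: "polytope (unit_cube d)"
  unfolding unit_cube_eq_convex_hull_corners by (intro polytope_convex_hull) auto

lemma vertices_unit_cube: "vertices (unit_cube d) = corner ` Pow {..<d}"
proof
  show "vertices (unit_cube d) \<subseteq> corner ` Pow {..<d}"
    unfolding vertices_def unit_cube_eq_convex_hull_corners by (rule extreme_points_of_convex_hull)
  show "corner ` Pow {..<d} \<subseteq> vertices (unit_cube d)"
  proof clarify
    fix X assume X: "X \<subseteq> {..<d}"
    have "x = corner X" if "x \<in> interval_face d X X" for x
    proof (rule poly_mapping_eqI)
      fix i show "Poly_Mapping.lookup x i = Poly_Mapping.lookup (corner X) i"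
        using that finite_subset[OF X]
        by (cases "i < d") (auto simp: interval_face_def unit_cube_def lookup_corner not_less)
    qed
    moreover have "corner X \<in> interval_face d X X"
      using corner_in_interval_face_iff[OF X X, of X] by simp
    ultimately have "interval_face d X X = {corner X}" by blast
    then show "corner X \<in> vertices (unit_cube d)"
      using interval_face_is_face[OF X, of X] by (simp add: vertices_iff_face)
  qed
qed

lemma vertices_interval_face:
  assumes "I \<subseteq> {..<d}"
  shows "vertices (interval_face d I J) = corner ` {X. X \<subseteq> {..<d} \<and> I \<subseteq> X \<and> X \<subseteq> J}"
proof -
  have "corner X \<in> interval_face d I J \<longleftrightarrow> I \<subseteq> X \<and> X \<subseteq> J" if "X \<subseteq> {..<d}" for X
    using that assms by (rule corner_in_interval_face_iff)
  then have "corner ` Pow {..<d} \<inter> interval_face d I J = corner ` {X. X \<subseteq> {..<d} \<and> I \<subseteq> X \<and> X \<subseteq> J}"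
    by blast
  then show ?thesis
    using vertices_face[OF interval_face_is_face[OF assms]] vertices_unit_cube by metis
qed

text \<open>
  If \<open>X\<close> and \<open>Y\<close> differ in more than the element \<open>i\<close>, then exchanging the membership of \<open>i\<close> in both gives
  another pair of corners with the same midpoint, so a face that contains the segment from \<open>X\<close> to \<open>Y\<close>
  contains further corners and is no edge.
\<close>

lemma adjacent_unit_cube_iff:
  assumes X: "X \<subseteq> {..<d}" and Y: "Y \<subseteq> {..<d}"
  shows "adjacent (unit_cube d) (corner X) (corner Y) \<longleftrightarrow> (\<exists>i<d. Y = flip X {i})"
  unfolding flip_def
proof
  have fin: "finite X" "finite Y" using finite_subset[OF X] finite_subset[OF Y] by simp_all
  assume a: "adjacent (unit_cube d) (corner X) (corner Y)"
  then have "X \<noteq> Y" and "\<exists>F. F face_of unit_cube d \<and> vertices F = {corner X, corner Y}"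
    by (auto simp: adjacent_iff_face_with_two_vertices[OF polytope_unit_cube])
  then obtain F where F: "F face_of unit_cube d" "vertices F = {corner X, corner Y}"
    and neq: "X \<noteq> Y" by blast
  have "sym_diff X Y \<noteq> {}" using neq by auto
  then obtain i where i: "i \<in> sym_diff X Y" by blast
  have id: "i < d" using i X Y by auto
  show "\<exists>i<d. Y = sym_diff X {i}"
  proof (rule ccontr)
    assume no: "\<not> (\<exists>i<d. Y = sym_diff X {i})"
    define X' Y' where "X' = sym_diff X {i}" and "Y' = sym_diff Y {i}"
    let ?m = "(1/2) *\<^sub>R corner X + (1/2) *\<^sub>R corner Y"
    have sub: "X' \<subseteq> {..<d}" "Y' \<subseteq> {..<d}"
      using X Y id by (auto simp: X'_def Y'_def)
    have fin': "finite X'" "finite Y'"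
      using finite_subset[OF sub(1)] finite_subset[OF sub(2)] by simp_all
    have mem: "k \<in> X' \<longleftrightarrow> (k \<in> X) \<noteq> (k = i)" "k \<in> Y' \<longleftrightarrow> (k \<in> Y) \<noteq> (k = i)" for k
      by (auto simp: X'_def Y'_def)
    have i_mem: "i \<in> X \<longleftrightarrow> i \<notin> Y" using i by blast
    have m: "?m = (1 - 1/2) *\<^sub>R corner X' + (1/2) *\<^sub>R corner Y'"
    proof (rule poly_mapping_eqI)
      fix k show "Poly_Mapping.lookup ?m k =
          Poly_Mapping.lookup ((1 - 1/2) *\<^sub>R corner X' + (1/2) *\<^sub>R corner Y') k"
        by (cases "k = i") (simp_all add: lookup_add lookup_corner fin fin' mem i_mem)
    qed
    have "\<exists>k. (k \<in> X) \<noteq> (k \<in> Y)" using neq by blast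
    then have "X' \<noteq> Y'" using mem by blast
    then have "corner X' \<noteq> corner Y'" using corner_inject fin' by blast
    then have open_seg: "?m \<in> open_segment (corner X') (corner Y')"
      unfolding in_segment using m by (intro conjI exI[of _ "1/2"]) auto
    have "corner X \<in> F" "corner Y \<in> F" using F(2) vertices_subset[of F] by auto
    then have "?m \<in> F"
      using face_of_imp_convex[OF F(1)] by (intro convexD) auto
    then have "corner X' \<in> F"
      using face_ofD[OF F(1) open_seg] corner_in_unit_cube sub(1,2) by blast
    then have "corner X' \<in> vertices F"
      using vertices_face[OF F(1)] sub(1) by (auto simp: vertices_unit_cube)
    then have "X' = X \<or> X' = Y"
      using F(2) corner_inject fin fin'(1) by blast
    moreover have "X' \<noteq> X" using mem[of i] by blast
    ultimately show False using no id unfolding X'_def by blast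
  qed
next
  assume "\<exists>i<d. Y = sym_diff X {i}"
  then obtain i where i: "i < d" "Y = sym_diff X {i}" by blast
  have fin: "finite X" "finite Y" using finite_subset[OF X] finite_subset[OF Y] by simp_all
  have IJ: "X - {i} \<subseteq> {..<d}" using X by auto
  have "{Z. Z \<subseteq> {..<d} \<and> X - {i} \<subseteq> Z \<and> Z \<subseteq> insert i X} = {X, Y}"
    using i X by auto
  then have "vertices (interval_face d (X - {i}) (insert i X)) = {corner X, corner Y}"
    using vertices_interval_face[OF IJ, of "insert i X"] by simp
  moreover have "corner X \<noteq> corner Y" using i corner_inject[OF fin] by blast
  ultimately show "adjacent (unit_cube d) (corner X) (corner Y)"
    unfolding adjacent_iff_face_with_two_vertices[OF polytope_unit_cube]
    using interval_face_is_face[OF IJ] by blast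
qed

text \<open>
  Only the two features of the cube that the proof uses are transported: the edges, and the fact
  that intervals of subsets span faces, to which the unique sink condition will be applied.
\<close>

lemma combinatorial_cube_coordinates:
  assumes "combinatorial_cube d (P :: 'a::real_vector set)"
  obtains v where
    "bij_betw v (Pow {..<d}) (vertices P)"
    "\<And>X Y. X \<subseteq> {..<d} \<Longrightarrow> Y \<subseteq> {..<d} \<Longrightarrow>
       adjacent P (v X) (v Y) \<longleftrightarrow> (\<exists>i<d. Y = flip X {i})"
    "\<And>I J. I \<subseteq> {..<d} \<Longrightarrow>
       \<exists>F. F face_of P \<and> vertices F = v ` {X. X \<subseteq> {..<d} \<and> I \<subseteq> X \<and> X \<subseteq> J}"
proof -
  have P: "polytope P" and iso: "face_lattices_isomorphic P (unit_cube d)"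
    using assms by (auto simp: combinatorial_cube_def)
  obtain f \<pi> where f: "bij_betw f {F. F face_of P} {G. G face_of unit_cube d}"
    and \<pi>: "bij_betw \<pi> (vertices P) (vertices (unit_cube d))"
    and vf: "\<And>F. F face_of P \<Longrightarrow> vertices (f F) = \<pi> ` vertices F"
    using face_lattice_iso_vertices[OF P polytope_unit_cube iso] by metis
  define \<rho> where "\<rho> = the_inv_into (vertices P) \<pi>"
  define v where "v = \<rho> \<circ> corner"
  have fface: "f F face_of unit_cube d" if "F face_of P" for F
    using f that by (auto simp: bij_betw_def)
  have fsurj: "\<exists>F. F face_of P \<and> f F = G" if "G face_of unit_cube d" for G
  proof -
    have "G \<in> f ` {F. F face_of P}" using bij_betw_imp_surj_on[OF f] that by simp
    then show ?thesis by auto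
  qed
  have \<rho>: "bij_betw \<rho> (vertices (unit_cube d)) (vertices P)"
    unfolding \<rho>_def using \<pi> by (rule bij_betw_the_inv_into)
  have \<pi>\<rho>: "\<pi> (\<rho> y) = y" if "y \<in> vertices (unit_cube d)" for y
    using f_the_inv_into_f_bij_betw[OF \<pi>] that by (simp add: \<rho>_def)
  have \<rho>\<pi>: "\<rho> (\<pi> x) = x" if "x \<in> vertices P" for x
    using the_inv_into_f_f[of \<pi> "vertices P"] \<pi> that by (simp add: \<rho>_def bij_betw_def)
  have corner: "bij_betw corner (Pow {..<d}) (vertices (unit_cube d))"
    unfolding bij_betw_def vertices_unit_cube
    using corner_inject finite_subset[of _ "{..<d}"] by (auto intro!: inj_onI)
  have v: "bij_betw v (Pow {..<d}) (vertices P)"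
    unfolding v_def using corner \<rho> by (rule bij_betw_trans)
  have face: "\<exists>F. F face_of P \<and> vertices F = \<rho> ` vertices G" if G: "G face_of unit_cube d" for G
  proof -
    obtain F where F: "F face_of P" "f F = G" using fsurj[OF G] by blast
    have "\<rho> ` vertices G = (\<lambda>x. x) ` vertices F"
      unfolding F(2)[symmetric] vf[OF F(1)] image_image
      using \<rho>\<pi> vertices_face[OF F(1)] by (intro image_cong) auto
    then show ?thesis using F by auto
  qed
  have "adjacent P (\<rho> a) (\<rho> b) \<longleftrightarrow> adjacent (unit_cube d) a b"
    if ab: "a \<in> vertices (unit_cube d)" "b \<in> vertices (unit_cube d)" for a b
  proof -
    have "(\<exists>F. F face_of P \<and> vertices F = {\<rho> a, \<rho> b}) \<longleftrightarrow>
        (\<exists>G. G face_of unit_cube d \<and> vertices G = {a, b})"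
    proof
      assume "\<exists>F. F face_of P \<and> vertices F = {\<rho> a, \<rho> b}"
      then obtain F where F: "F face_of P" "vertices F = {\<rho> a, \<rho> b}" by blast
      have "vertices (f F) = {a, b}" using vf[OF F(1)] F(2) \<pi>\<rho> ab by simp
      then show "\<exists>G. G face_of unit_cube d \<and> vertices G = {a, b}" using fface[OF F(1)] by blast
    next
      assume "\<exists>G. G face_of unit_cube d \<and> vertices G = {a, b}"
      then obtain G where G: "G face_of unit_cube d" "vertices G = {a, b}" by blast
      then show "\<exists>F. F face_of P \<and> vertices F = {\<rho> a, \<rho> b}" using face[OF G(1)] by simp
    qed
    moreover have "\<rho> a = \<rho> b \<longleftrightarrow> a = b"
      using \<rho> ab by (auto simp: bij_betw_def inj_on_def)
    ultimately show ?thesis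
      unfolding adjacent_iff_face_with_two_vertices[OF P]
        adjacent_iff_face_with_two_vertices[OF polytope_unit_cube] by simp
  qed
  then have adj: "adjacent P (v X) (v Y) \<longleftrightarrow> (\<exists>i<d. Y = flip X {i})"
    if "X \<subseteq> {..<d}" "Y \<subseteq> {..<d}" for X Y
    unfolding v_def o_def adjacent_unit_cube_iff[OF that, symmetric]
    using that by (simp add: vertices_unit_cube)
  have face_v: "\<exists>F. F face_of P \<and> vertices F = v ` {X. X \<subseteq> {..<d} \<and> I \<subseteq> X \<and> X \<subseteq> J}"
    if "I \<subseteq> {..<d}" for I J
    using face[OF interval_face_is_face[OF that, of J]] vertices_interval_face[OF that, of J]
    by (simp add: v_def image_comp)
  show ?thesis by (rule that[OF v adj face_v])
qed

section \<open>Averages over outgoing arcs\<close>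

text \<open>Counts the covering pairs of the Boolean lattice once from above and once from below.\<close>

lemma sum_remove_element_reindex:
  fixes g :: "'a set \<Rightarrow> 'a \<Rightarrow> real"
  assumes "finite D"
  shows "(\<Sum>S\<in>Pow D. \<Sum>i\<in>S. g (S - {i}) i) = (\<Sum>T\<in>Pow D. \<Sum>i\<in>D - T. g T i)"
proof -
  have "(\<Sum>S\<in>Pow D. \<Sum>i\<in>S. g (S - {i}) i) = (\<Sum>(S, i)\<in>Sigma (Pow D) (\<lambda>S. S). g (S - {i}) i)"
    using assms by (intro sum.Sigma) (auto intro: finite_subset)
  also have "\<dots> = (\<Sum>(T, i)\<in>Sigma (Pow D) (\<lambda>T. D - T). g T i)"
    by (rule sum.reindex_bij_witness[of _ "\<lambda>(T, i). (insert i T, i)" "\<lambda>(S, i). (S - {i}, i)"]) auto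
  also have "\<dots> = (\<Sum>T\<in>Pow D. \<Sum>i\<in>D - T. g T i)"
    using assms by (intro sum.Sigma[symmetric]) auto
  finally show ?thesis .
qed

text \<open>
  An acyclic unique sink orientation in the form of its outmap: \<open>out X\<close> is the set of directions of the
  arcs leaving \<open>X\<close>. Acyclicity is witnessed by \<open>rank\<close>, a linear extension. In \<open>unique_sink\<close>, the
  condition \<open>X - S = Y - S\<close> says that \<open>X\<close> and \<open>Y\<close> lie in a common face with set of directions \<open>S\<close>.
\<close>

locale cube_auso =
  fixes d :: nat and out :: "nat set \<Rightarrow> nat set" and rank :: "nat set \<Rightarrow> nat"
  assumes out_subset: "X \<subseteq> {..<d} \<Longrightarrow> out X \<subseteq> {..<d}"
    and rank_inj: "inj_on rank (Pow {..<d})"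
    and rank_bound: "X \<subseteq> {..<d} \<Longrightarrow> rank X < 2 ^ d"
    and rank_decreasing: "X \<subseteq> {..<d} \<Longrightarrow> i \<in> out X \<Longrightarrow> rank (flip X {i}) < rank X"
    and unique_sink: "X \<subseteq> {..<d} \<Longrightarrow> Y \<subseteq> {..<d} \<Longrightarrow> X - S = Y - S \<Longrightarrow>
      out X \<inter> S = {} \<Longrightarrow> out Y \<inter> S = {} \<Longrightarrow> X = Y"
begin

text \<open>
  The transition operator of Random-Edge. At the sink the sum is empty, so the walk is killed there,
  and a nonnegative constant is an upper bound of its average.
\<close>

definition avg :: "(nat set \<Rightarrow> real) \<Rightarrow> nat set \<Rightarrow> real" where
  "avg f X = (\<Sum>i\<in>out X. f (flip X {i})) / real (card (out X))"

lemma finite_out: "X \<subseteq> {..<d} \<Longrightarrow> finite (out X)"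
  using out_subset finite_subset by blast

lemma step_in_cube: "X \<subseteq> {..<d} \<Longrightarrow> i \<in> out X \<Longrightarrow> flip X {i} \<subseteq> {..<d}"
  using out_subset by (intro flip_subset) auto

lemma avg_mono:
  assumes "\<And>i. i \<in> out X \<Longrightarrow> f (flip X {i}) \<le> g (flip X {i})"
  shows "avg f X \<le> avg g X"
  unfolding avg_def using assms by (intro divide_right_mono sum_mono) auto

lemma avg_add: "avg (\<lambda>Y. f Y + g Y) X = avg f X + avg g X"
  by (simp add: avg_def sum.distrib add_divide_distrib)

lemma avg_scale: "avg (\<lambda>Y. c * f Y) X = c * avg f X"
  by (simp add: avg_def sum_distrib_left[symmetric])

lemma avg_sum: "avg (\<lambda>Y. \<Sum>j\<in>J. f j Y) X = (\<Sum>j\<in>J. avg (f j) X)"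
  unfolding avg_def sum_divide_distrib by (rule sum.swap)

lemma avg_const_le: "0 \<le> c \<Longrightarrow> avg (\<lambda>_. c) X \<le> c"
  by (cases "card (out X) = 0") (auto simp: avg_def)

lemma avg_le_const:
  assumes "0 \<le> c" "\<And>i. i \<in> out X \<Longrightarrow> f (flip X {i}) \<le> c"
  shows "avg f X \<le> c"
  using avg_mono[of X f "\<lambda>_. c"] avg_const_le[OF assms(1), of X] assms(2) by simp

abbreviation avg_iter :: "nat \<Rightarrow> (nat set \<Rightarrow> real) \<Rightarrow> nat set \<Rightarrow> real" where
  "avg_iter j \<equiv> avg ^^ j"

lemma avg_iter_mono:
  assumes "\<And>Y. Y \<subseteq> {..<d} \<Longrightarrow> f Y \<le> g Y" "X \<subseteq> {..<d}"
  shows "avg_iter j f X \<le> avg_iter j g X"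
  using assms(2)
proof (induction j arbitrary: X)
  case (Suc j)
  then show ?case using step_in_cube by (simp add: avg_mono)
qed (use assms(1) in simp)

lemma avg_iter_add: "avg_iter j (\<lambda>Y. f Y + g Y) X = avg_iter j f X + avg_iter j g X"
proof (induction j arbitrary: X)
  case (Suc j)
  then have "avg_iter j (\<lambda>Y. f Y + g Y) = (\<lambda>Y. avg_iter j f Y + avg_iter j g Y)" by blast
  then show ?case by (simp add: avg_add)
qed simp

lemma avg_iter_diff: "avg_iter j (\<lambda>Y. f Y - g Y) X = avg_iter j f X - avg_iter j g X"
  using avg_iter_add[of j "\<lambda>Y. f Y - g Y" g X] by simp

lemma avg_iter_le:
  assumes "\<And>Y. Y \<subseteq> {..<d} \<Longrightarrow> avg f Y \<le> f Y" "X \<subseteq> {..<d}"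
  shows "avg_iter j f X \<le> f X"
  using assms(2)
proof (induction j arbitrary: X)
  case (Suc j)
  have "avg (avg_iter j f) X \<le> avg f X"
    using Suc step_in_cube by (intro avg_mono) blast
  then show ?case using assms(1)[OF Suc.prems] by simp
qed simp

lemma avg_iter_le_const:
  assumes "0 \<le> c" "\<And>Y. Y \<subseteq> {..<d} \<Longrightarrow> f Y \<le> c" "X \<subseteq> {..<d}"
  shows "avg_iter j f X \<le> c"
proof -
  have "avg_iter j f X \<le> avg_iter j (\<lambda>_. c) X" using assms by (intro avg_iter_mono)
  also have "\<dots> \<le> c" using avg_const_le assms by (intro avg_iter_le) auto
  finally show ?thesis .
qed

lemma avg_iter_nonneg:
  assumes "\<And>Y. Y \<subseteq> {..<d} \<Longrightarrow> 0 \<le> f Y" "X \<subseteq> {..<d}"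
  shows "0 \<le> avg_iter j f X"
proof -
  have "avg_iter j (\<lambda>_. 0) Y = 0" for Y
    by (induction j arbitrary: Y) (auto simp: avg_def)
  then show ?thesis using avg_iter_mono[of "\<lambda>_. 0" f X j] assms by simp
qed

section \<open>Short walks in pairwise distinct directions\<close>

definition low :: "nat set \<Rightarrow> bool" where
  "low X \<longleftrightarrow> 4 * card (out X) < d"

definition step_weight :: "nat set \<Rightarrow> nat set \<Rightarrow> nat \<Rightarrow> real" where
  "step_weight X T i =
     (if i \<in> out (flip X T) \<and> \<not> low (flip X T) then 1 / real (card (out (flip X T))) else 0)"

text \<open>
  \<open>path_weight X j S\<close> is the probability that the first \<open>j\<close> steps from \<open>X\<close> start at vertices that are
  not low and use each direction in \<open>S\<close> exactly once, and no other. The recursion is on the last direction \<open>i\<close>,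
  so \<open>step_weight X T i\<close> is the probability of the step in direction \<open>i\<close> after the directions \<open>T\<close>.
\<close>

primrec path_weight :: "nat set \<Rightarrow> nat \<Rightarrow> nat set \<Rightarrow> real" where
  "path_weight X 0 S = of_bool (S = {})"
| "path_weight X (Suc j) S = (\<Sum>i\<in>S. step_weight X (S - {i}) i * path_weight X j (S - {i}))"

lemma step_weight_nonneg: "0 \<le> step_weight X T i"
  by (simp add: step_weight_def)

lemma path_weight_nonneg: "0 \<le> path_weight X j S"
  by (induction j arbitrary: S) (auto intro!: sum_nonneg mult_nonneg_nonneg step_weight_nonneg)

lemma path_weight_support:
  assumes "X \<subseteq> {..<d}" "S \<subseteq> {..<d}" "path_weight X j S \<noteq> 0"
  shows "card S = j \<and> rank (flip X S) \<le> rank X"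
  using assms(2,3)
proof (induction j arbitrary: S)
  case 0
  then show ?case by (simp split: if_splits)
next
  case (Suc j)
  then obtain i where i: "i \<in> S" "step_weight X (S - {i}) i * path_weight X j (S - {i}) \<noteq> 0"
    using sum.not_neutral_contains_not_neutral by (metis (no_types, lifting) path_weight.simps(2))
  then have IH: "card (S - {i}) = j" "rank (flip X (S - {i})) \<le> rank X"
    using Suc.IH[of "S - {i}"] Suc.prems(1) by auto
  have out: "i \<in> out (flip X (S - {i}))"
    using i(2) by (simp add: step_weight_def split: if_splits)
  have sub: "flip X (S - {i}) \<subseteq> {..<d}"
    using assms(1) Suc.prems(1) by (intro flip_subset) auto
  have "flip X S = flip (flip X (S - {i})) {i}"
    using i(1) flip_insert[of i "S - {i}" X] by (simp add: insert_absorb)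
  then have "rank (flip X S) < rank (flip X (S - {i}))"
    using rank_decreasing[OF sub out] by simp
  moreover have "card S = Suc j"
    using i(1) IH(1) finite_subset[OF Suc.prems(1)] by (metis card_Suc_Diff1 finite_lessThan)
  ultimately show ?case using IH(2) by simp
qed

lemma step_weight_le:
  assumes "1 \<le> d"
  shows "step_weight X T i \<le> 4 / real d"
proof -
  have "1 / real (card (out (flip X T))) \<le> 4 / real d" if "d \<le> 4 * card (out (flip X T))"
    using that assms by (simp add: field_simps)
  then show ?thesis by (simp add: step_weight_def low_def)
qed

text \<open>There are \<open>j!\<close> orders of the directions, and each step has probability at most \<open>4 / d\<close>.\<close>

lemma path_weight_le:
  assumes "1 \<le> d" "X \<subseteq> {..<d}" "S \<subseteq> {..<d}"
  shows "path_weight X j S \<le> fact j * (4 / real d) ^ j"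
  using assms(3)
proof (induction j arbitrary: S)
  case (Suc j)
  show ?case
  proof (cases "path_weight X (Suc j) S = 0")
    case True
    then show ?thesis by simp
  next
    case False
    then have card: "card S = Suc j"
      using path_weight_support[OF assms(2) Suc.prems] by blast
    have "path_weight X (Suc j) S \<le> (\<Sum>i\<in>S. (4 / real d) * (fact j * (4 / real d) ^ j))"
      unfolding path_weight.simps using Suc.prems
      by (intro sum_mono mult_mono Suc.IH step_weight_le assms(1) path_weight_nonneg) auto
    also have "\<dots> = fact (Suc j) * (4 / real d) ^ Suc j"
      using card by (simp add: algebra_simps)
    finally show ?thesis .
  qed
qed simp

lemma sum_path_weight_Suc:
  "(\<Sum>S\<in>Pow {..<d}. path_weight X (Suc j) S * f (flip X S)) =
   (\<Sum>T\<in>Pow {..<d}. path_weight X j T *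
      (\<Sum>i\<in>{..<d} - T. step_weight X T i * f (flip (flip X T) {i})))"
proof -
  let ?g = "\<lambda>T i. step_weight X T i * path_weight X j T * f (flip (flip X T) {i})"
  have "path_weight X (Suc j) S * f (flip X S) = (\<Sum>i\<in>S. ?g (S - {i}) i)" for S
    unfolding path_weight.simps sum_distrib_right
  proof (rule sum.cong[OF refl])
    fix i assume "i \<in> S"
    then have "flip X S = flip (flip X (S - {i})) {i}"
      using flip_insert[of i "S - {i}" X] by (simp add: insert_absorb)
    then show "step_weight X (S - {i}) i * path_weight X j (S - {i}) * f (flip X S) = ?g (S - {i}) i"
      by simp
  qed
  then have "(\<Sum>S\<in>Pow {..<d}. path_weight X (Suc j) S * f (flip X S)) =
      (\<Sum>S\<in>Pow {..<d}. \<Sum>i\<in>S. ?g (S - {i}) i)"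
    by simp
  also have "\<dots> = (\<Sum>T\<in>Pow {..<d}. \<Sum>i\<in>{..<d} - T. ?g T i)"
    by (rule sum_remove_element_reindex) simp
  finally show ?thesis
    by (simp add: sum_distrib_left mult_ac)
qed

text \<open>
  The weights describe a part of the paths of the walk, so for nonnegative \<open>f\<close> they give no more
  than the expectation of \<open>f\<close> after \<open>j\<close> steps.
\<close>

lemma path_weight_dominated:
  assumes "\<And>Y. Y \<subseteq> {..<d} \<Longrightarrow> 0 \<le> f Y" "X \<subseteq> {..<d}"
  shows "(\<Sum>S\<in>Pow {..<d}. path_weight X j S * f (flip X S)) \<le> avg_iter j f X"
  using assms(1)
proof (induction j arbitrary: f)
  case 0
  have "(\<Sum>S\<in>Pow {..<d}. path_weight X 0 S * f (flip X S)) =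
      (\<Sum>S\<in>{{}}. path_weight X 0 S * f (flip X S))"
    by (intro sum.mono_neutral_right) auto
  then show ?case by simp
next
  case (Suc j)
  have step: "(\<Sum>i\<in>{..<d} - T. step_weight X T i * f (flip (flip X T) {i})) \<le> avg f (flip X T)"
    if T: "T \<subseteq> {..<d}" for T
  proof -
    let ?Y = "flip X T"
    have Y: "?Y \<subseteq> {..<d}" using assms(2) T by (rule flip_subset)
    have nonneg: "0 \<le> f (flip ?Y {i})" if "i < d" for i
      using that by (intro Suc.prems flip_subset Y) auto
    have "(\<Sum>i\<in>{..<d} - T. step_weight X T i * f (flip ?Y {i})) \<le>
        (\<Sum>i\<in>{..<d}. step_weight X T i * f (flip ?Y {i}))"
      using nonneg step_weight_nonneg by (intro sum_mono2) auto
    also have "\<dots> = (\<Sum>i\<in>out ?Y. step_weight X T i * f (flip ?Y {i}))"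
      using out_subset[OF Y] by (intro sum.mono_neutral_right) (auto simp: step_weight_def)
    also have "\<dots> \<le> (\<Sum>i\<in>out ?Y. (1 / card (out ?Y)) * f (flip ?Y {i}))"
      using out_subset[OF Y] nonneg
      by (intro sum_mono mult_right_mono) (auto simp: step_weight_def)
    also have "\<dots> = avg f ?Y"
      by (simp add: avg_def sum_divide_distrib)
    finally show ?thesis .
  qed
  have "(\<Sum>S\<in>Pow {..<d}. path_weight X (Suc j) S * f (flip X S)) \<le>
      (\<Sum>T\<in>Pow {..<d}. path_weight X j T * avg f (flip X T))"
    unfolding sum_path_weight_Suc
    using step path_weight_nonneg by (intro sum_mono mult_left_mono) auto
  also have "\<dots> \<le> avg_iter j (avg f) X"
  proof (rule Suc.IH)
    fix Y assume "Y \<subseteq> {..<d}"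
    then show "0 \<le> avg f Y"
      unfolding avg_def using Suc.prems step_in_cube by (intro divide_nonneg_nonneg sum_nonneg) auto
  qed
  finally show ?case by (simp add: funpow_swap1)
qed

abbreviation low_ind :: "nat set \<Rightarrow> real" where
  "low_ind X \<equiv> of_bool (low X)"

text \<open>
  In step \<open>j + 1\<close> a path is lost if it is at a low vertex or if it repeats one of its \<open>j\<close> directions;
  the latter has probability at most \<open>j\<close> divided by an outdegree of at least \<open>d / 4\<close>.
\<close>

lemma path_weight_mass_Suc:
  assumes "1 \<le> d" "X \<subseteq> {..<d}"
  shows "(\<Sum>S\<in>Pow {..<d}. path_weight X j S) - avg_iter j low_ind X - 4 * real j / real d
    \<le> (\<Sum>S\<in>Pow {..<d}. path_weight X (Suc j) S)"
proof -
  have step: "path_weight X j T * (1 - low_ind (flip X T) - 4 * real j / real d)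
      \<le> path_weight X j T * (\<Sum>i\<in>{..<d} - T. step_weight X T i)" if T: "T \<subseteq> {..<d}" for T
  proof (cases "path_weight X j T = 0")
    case False
    let ?Y = "flip X T" and ?k = "card (out (flip X T))"
    have card: "card T = j" using path_weight_support[OF assms(2) T False] by blast
    have Y: "?Y \<subseteq> {..<d}" using assms(2) T by (rule flip_subset)
    have "1 - low_ind ?Y - 4 * real j / real d \<le> (\<Sum>i\<in>{..<d} - T. step_weight X T i)"
    proof (cases "low ?Y")
      case True
      then show ?thesis by (simp add: step_weight_def)
    next
      case False
      then have k: "real d \<le> 4 * real ?k" "0 < ?k"
        using assms(1) by (auto simp: low_def)
      have "?k - j \<le> card (out ?Y - T)"
        using diff_card_le_card_Diff[of T "out ?Y"] card T finite_subset by fastforce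
      then have "real ?k - real j \<le> real (card (out ?Y - T))" by linarith
      then have "(real ?k - real j) / real ?k \<le> real (card (out ?Y - T)) / real ?k"
        by (intro divide_right_mono) auto
      then have "1 - real j / real ?k \<le> real (card (out ?Y - T)) / real ?k"
        using k(2) by (simp add: diff_divide_distrib)
      also have "\<dots> = (\<Sum>i\<in>out ?Y - T. step_weight X T i)"
        using False by (simp add: step_weight_def)
      also have "\<dots> = (\<Sum>i\<in>{..<d} - T. step_weight X T i)"
        using out_subset[OF Y] by (intro sum.mono_neutral_left) (auto simp: step_weight_def)
      finally have "1 - real j / real ?k \<le> (\<Sum>i\<in>{..<d} - T. step_weight X T i)" .
      moreover have "real j / real ?k \<le> 4 * real j / real d"
      proof -
        have "real j * real d \<le> real j * (4 * real ?k)"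
          using k(1) by (intro mult_left_mono) auto
        then show ?thesis using k assms(1) by (simp add: field_simps)
      qed
      ultimately show ?thesis using False by simp
    qed
    then show ?thesis using path_weight_nonneg by (intro mult_left_mono)
  qed simp
  have total: "(\<Sum>S\<in>Pow {..<d}. path_weight X j S) \<le> 1"
    using path_weight_dominated[of "\<lambda>_. 1" X j] avg_iter_le_const[of 1 "\<lambda>_. 1" X j] assms(2) by simp
  have low: "(\<Sum>S\<in>Pow {..<d}. path_weight X j S * low_ind (flip X S)) \<le> avg_iter j low_ind X"
    using assms(2) by (intro path_weight_dominated) auto
  have "(\<Sum>S\<in>Pow {..<d}. path_weight X j S) * (4 * real j / real d) \<le> 1 * (4 * real j / real d)"
    using total by (intro mult_right_mono) auto
  moreover have "(\<Sum>S\<in>Pow {..<d}. path_weight X j S * (1 - low_ind (flip X S) - 4 * real j / real d))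
      = (\<Sum>S\<in>Pow {..<d}. path_weight X j S) - (\<Sum>S\<in>Pow {..<d}. path_weight X j S * low_ind (flip X S))
        - (\<Sum>S\<in>Pow {..<d}. path_weight X j S) * (4 * real j / real d)"
    by (simp only: right_diff_distrib mult_1_right sum_subtractf sum_distrib_right)
  ultimately have "(\<Sum>S\<in>Pow {..<d}. path_weight X j S) - avg_iter j low_ind X - 4 * real j / real d
    \<le> (\<Sum>S\<in>Pow {..<d}. path_weight X j S * (1 - low_ind (flip X S) - 4 * real j / real d))"
    using low by linarith
  also have "\<dots> \<le> (\<Sum>T\<in>Pow {..<d}. path_weight X j T * (\<Sum>i\<in>{..<d} - T. step_weight X T i))"
    using step by (intro sum_mono) auto
  also have "\<dots> = (\<Sum>S\<in>Pow {..<d}. path_weight X (Suc j) S)"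
    using sum_path_weight_Suc[of X j "\<lambda>_. 1"] by simp
  finally show ?thesis .
qed

lemma path_weight_mass:
  assumes "1 \<le> d" "X \<subseteq> {..<d}" "j \<le> t"
  shows "1 - (\<Sum>l<j. avg_iter l low_ind X) - real j * (4 * real t / real d)
    \<le> (\<Sum>S\<in>Pow {..<d}. path_weight X j S)"
  using assms(3)
proof (induction j)
  case 0
  have "(\<Sum>S\<in>Pow {..<d}. path_weight X 0 S) = (\<Sum>S\<in>{{}}. path_weight X 0 S)"
    by (intro sum.mono_neutral_right) auto
  then show ?case by simp
next
  case (Suc j)
  have "4 * real j / real d \<le> 4 * real t / real d"
    using Suc.prems by (intro divide_right_mono) auto
  moreover have "real (Suc j) * (4 * real t / real d) = real j * (4 * real t / real d) + 4 * real t / real d"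
    by (simp only: of_nat_Suc distrib_right mult_1_left add.commute)
  moreover have "(\<Sum>l<Suc j. avg_iter l low_ind X) = (\<Sum>l<j. avg_iter l low_ind X) + avg_iter j low_ind X"
    by simp
  moreover note path_weight_mass_Suc[OF assms(1,2), of j]
  ultimately show ?case
    using Suc by linarith
qed

text \<open>
  As \<open>rank\<close> is injective, at most \<open>r\<close> endpoints have a rank among the \<open>r\<close> values up to \<open>rank X\<close>, and
  each has weight at most \<open>M\<close>. All other paths lose at least \<open>r\<close>. The paths that the weights
  ignore do no harm because the rank never increases along the walk.
\<close>

lemma rank_drop:
  assumes X: "X \<subseteq> {..<d}" and M: "\<And>S. S \<subseteq> {..<d} \<Longrightarrow> path_weight X t S \<le> M"
  shows "real r * ((\<Sum>S\<in>Pow {..<d}. path_weight X t S) - real r * M)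
    \<le> real (rank X) - avg_iter t (\<lambda>Y. real (rank Y)) X"
proof -
  let ?c = "real (rank X)"
  define f where "f Y = max 0 (?c - real (rank Y))" for Y
  define bad where "bad = {S \<in> Pow {..<d}. rank (flip X S) \<le> rank X \<and> rank X < rank (flip X S) + r}"
  have M0: "0 \<le> M" using M[of "{}"] path_weight_nonneg[of X t "{}"] by simp
  have card_bad: "card bad \<le> r"
  proof -
    have "inj_on (\<lambda>S. rank (flip X S)) bad"
    proof (rule inj_onI)
      fix S T assume *: "S \<in> bad" "T \<in> bad" "rank (flip X S) = rank (flip X T)"
      then have "flip X S = flip X T"
        using inj_onD[OF rank_inj *(3)] X flip_subset[of X "{..<d}"] by (auto simp: bad_def)
      then show "S = T" using flip_flip by metis
    qed
    moreover have "(\<lambda>S. rank (flip X S)) ` bad \<subseteq> {Suc (rank X) - r..rank X}"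
      by (auto simp: bad_def)
    ultimately have "card bad \<le> card {Suc (rank X) - r..rank X}"
      by (intro card_inj_on_le) auto
    then show ?thesis by simp
  qed
  have "real r * ((\<Sum>S\<in>Pow {..<d}. path_weight X t S) - real r * M)
      \<le> real r * ((\<Sum>S\<in>Pow {..<d}. path_weight X t S) - real (card bad) * M)"
    using card_bad M0 by (intro mult_left_mono diff_left_mono mult_right_mono) auto
  also have "real (card bad) * M = (\<Sum>S\<in>Pow {..<d}. of_bool (S \<in> bad) * M)"
  proof -
    have "Pow {..<d} \<inter> {S. S \<in> bad} = bad" by (auto simp: bad_def)
    then show ?thesis by (simp add: sum_distrib_right[symmetric])
  qed
  also have "real r * ((\<Sum>S\<in>Pow {..<d}. path_weight X t S) - (\<Sum>S\<in>Pow {..<d}. of_bool (S \<in> bad) * M))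
      = (\<Sum>S\<in>Pow {..<d}. real r * (path_weight X t S - of_bool (S \<in> bad) * M))"
    by (simp only: sum_subtractf sum_distrib_left right_diff_distrib)
  also have "\<dots> \<le> (\<Sum>S\<in>Pow {..<d}. path_weight X t S * f (flip X S))"
  proof (rule sum_mono)
    fix S assume S: "S \<in> Pow {..<d}"
    have nonneg: "0 \<le> path_weight X t S * f (flip X S)"
      using path_weight_nonneg by (simp add: f_def)
    show "real r * (path_weight X t S - of_bool (S \<in> bad) * M) \<le> path_weight X t S * f (flip X S)"
    proof (cases "S \<in> bad")
      case True
      then have "real r * (path_weight X t S - of_bool (S \<in> bad) * M) \<le> 0"
        using M[of S] S by (intro mult_nonneg_nonpos) auto
      then show ?thesis using nonneg by linarith
    next
      case False
      show ?thesis
      proof (cases "path_weight X t S = 0")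
        case pos: False
        then have "rank (flip X S) \<le> rank X"
          using path_weight_support[OF X _ pos] S by simp
        then have "real r \<le> f (flip X S)"
          using False S by (auto simp: bad_def f_def)
        then show ?thesis
          using False path_weight_nonneg[of X t S] mult_left_mono[of "real r" "f (flip X S)" "path_weight X t S"]
          by (simp add: mult.commute)
      qed (use False in simp)
    qed
  qed
  also have "\<dots> \<le> avg_iter t f X"
    using X by (intro path_weight_dominated) (auto simp: f_def)
  also have "\<dots> \<le> ?c - avg_iter t (\<lambda>Y. real (rank Y)) X"
  proof -
    \<comment> \<open>This is the maximum of \<open>rank Y\<close> and \<open>rank X\<close>: it cannot increase along arcs, either.\<close>
    let ?g = "\<lambda>Y. f Y + real (rank Y)"
    have "avg_iter t ?g X \<le> ?g X"
    proof (rule avg_iter_le[OF _ X])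
      fix Y assume Y: "Y \<subseteq> {..<d}"
      have "?g (flip Y {i}) \<le> ?g Y" if "i \<in> out Y" for i
        using rank_decreasing[OF Y that] by (auto simp: f_def)
      then show "avg ?g Y \<le> ?g Y"
        by (intro avg_le_const) (auto simp: f_def)
    qed
    then show ?thesis using avg_iter_add[of t f "\<lambda>Y. real (rank Y)" X] by (simp add: f_def)
  qed
  finally show ?thesis .
qed

section \<open>Vertices of low outdegree\<close>

definition low_vertices :: "nat set set" where
  "low_vertices = {X \<in> Pow {..<d}. low X}"

definition low_below :: "nat set \<Rightarrow> real" where
  "low_below X = real (card {Y \<in> low_vertices. rank Y \<le> rank X})"

lemma finite_low_vertices: "finite low_vertices"
  by (simp add: low_vertices_def)

lemma low_below_le: "low_below X \<le> real (card low_vertices)"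
  unfolding low_below_def using finite_low_vertices by (intro of_nat_mono card_mono) auto

text \<open>
  \<open>low_below\<close> is a potential for the number of visits to low vertices: it drops by at least one at each of
  them because the walk never returns to the rank that it leaves.
\<close>

lemma low_below_drop:
  assumes "X \<subseteq> {..<d}"
  shows "low_ind X \<le> low_below X - avg low_below X"
proof -
  let ?B = "{Y \<in> low_vertices. rank Y < rank X}"
  have "low_below (flip X {i}) \<le> real (card ?B)" if "i \<in> out X" for i
    unfolding low_below_def using rank_decreasing[OF assms that] finite_low_vertices
    by (intro of_nat_mono card_mono) auto
  then have "avg low_below X \<le> real (card ?B)"
    by (intro avg_le_const) auto
  moreover have "low_ind X + real (card ?B) \<le> low_below X"
  proof (cases "low X")
    case True
    then have "insert X ?B \<subseteq> {Y \<in> low_vertices. rank Y \<le> rank X}"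
      using assms by (auto simp: low_vertices_def)
    then have "card (insert X ?B) \<le> card {Y \<in> low_vertices. rank Y \<le> rank X}"
      using finite_low_vertices by (intro card_mono) auto
    then show ?thesis using True finite_low_vertices by (simp add: low_below_def)
  next
    case False
    have "card ?B \<le> card {Y \<in> low_vertices. rank Y \<le> rank X}"
      using finite_low_vertices by (intro card_mono) auto
    then show ?thesis using False by (simp add: low_below_def)
  qed
  ultimately show ?thesis by linarith
qed

text \<open>
  Double counting of the pairs of a vertex \<open>X\<close> and a set \<open>S\<close> of directions that contains no outgoing
  one: \<open>X\<close> is the sink of the face \<open>(X - S, S)\<close>, so \<open>X\<close> is determined by \<open>S\<close> and by \<open>X - S\<close>.
\<close>

lemma sum_two_power_indegree_le: "(\<Sum>X\<in>Pow {..<d}. 2 ^ (d - card (out X))) \<le> (3::nat) ^ d"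
proof -
  let ?D = "{..<d}"
  have "(\<Sum>X\<in>Pow ?D. (2::nat) ^ (d - card (out X))) = (\<Sum>X\<in>Pow ?D. \<Sum>S\<in>Pow ?D. of_bool (out X \<inter> S = {}))"
  proof (rule sum.cong[OF refl])
    fix X assume "X \<in> Pow ?D"
    then have "card (?D - out X) = d - card (out X)"
      using out_subset finite_out by (simp add: card_Diff_subset)
    moreover have "Pow ?D \<inter> {S. out X \<inter> S = {}} = Pow (?D - out X)" by auto
    ultimately show "2 ^ (d - card (out X)) = (\<Sum>S\<in>Pow ?D. of_bool (out X \<inter> S = {}) :: nat)"
      by (simp add: card_Pow)
  qed
  also have "\<dots> = (\<Sum>S\<in>Pow ?D. \<Sum>X\<in>Pow ?D. of_bool (out X \<inter> S = {}))"
    by (rule sum.swap)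
  also have "\<dots> \<le> (\<Sum>S\<in>Pow ?D. 2 ^ card (?D - S))"
  proof (rule sum_mono)
    fix S assume "S \<in> Pow ?D"
    have "inj_on (\<lambda>X. X - S) {X \<in> Pow ?D. out X \<inter> S = {}}"
      using unique_sink by (intro inj_onI) blast
    moreover have "(\<lambda>X. X - S) ` {X \<in> Pow ?D. out X \<inter> S = {}} \<subseteq> Pow (?D - S)" by auto
    ultimately have "card {X \<in> Pow ?D. out X \<inter> S = {}} \<le> card (Pow (?D - S))"
      by (intro card_inj_on_le) auto
    then show "(\<Sum>X\<in>Pow ?D. of_bool (out X \<inter> S = {})) \<le> (2::nat) ^ card (?D - S)"
      by (simp add: card_Pow Int_def)
  qed
  also have "\<dots> = (3::nat) ^ d"
    using prod_add[of ?D "\<lambda>_. 1::nat" "\<lambda>_. 2"] by (simp add: numeral_3_eq_3)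
  finally show ?thesis .
qed

lemma card_low_vertices_le: "real (card low_vertices) \<le> 2 ^ d * (3 / (2 * 2 powr (3/4))) ^ d"
proof -
  have "real (card low_vertices) * 2 powr (3/4 * real d) = (\<Sum>X\<in>low_vertices. 2 powr (3/4 * real d))"
    by simp
  also have "\<dots> \<le> (\<Sum>X\<in>low_vertices. real (2 ^ (d - card (out X))))"
  proof (rule sum_mono)
    fix X assume "X \<in> low_vertices"
    then have "3/4 * real d \<le> real (d - card (out X))"
      by (simp add: low_vertices_def low_def of_nat_diff)
    then have "2 powr (3/4 * real d) \<le> 2 powr real (d - card (out X))"
      by (intro powr_mono) auto
    then show "2 powr (3/4 * real d) \<le> real (2 ^ (d - card (out X)))"
      by (simp add: powr_realpow)
  qed
  also have "\<dots> \<le> (\<Sum>X\<in>Pow {..<d}. real (2 ^ (d - card (out X))))"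
    by (intro sum_mono2) (auto simp: low_vertices_def)
  also have "\<dots> \<le> 3 ^ d"
    using of_nat_mono[where 'a = real, OF sum_two_power_indegree_le] by simp
  finally have "real (card low_vertices) * 2 powr (3/4 * real d) \<le> 3 ^ d" .
  moreover have "2 powr (3/4 * real d) = (2 powr (3/4)) ^ d"
    by (simp add: powr_power mult.commute)
  ultimately show ?thesis
    by (simp add: power_divide power_mult_distrib pos_le_divide_eq)
qed

section \<open>Supersolutions of the expected number of visits\<close>

text \<open>
  From every vertex the next \<open>t\<close> steps either lose rank of the order of \<open>1 / M\<close> or meet low vertices. The
  assumption \<open>16 * t\<^sup>2 \<le> d\<close> keeps the probability of a repeated direction at most \<open>1/4\<close>.
\<close>

lemma rank_drop_or_low:
  assumes X: "X \<subseteq> {..<d}" and d: "1 \<le> d" "16 * t\<^sup>2 \<le> d"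
    and M: "M = fact t * (4 / real d) ^ t" "8 * M \<le> 1"
  shows "1 \<le> 16 * M * (real (rank X) - avg_iter t (\<lambda>Y. real (rank Y)) X)
    + 2 * (\<Sum>j<t. avg_iter j low_ind X)"
proof -
  \<comment> \<open>As large as possible, up to a constant, subject to \<open>r * M \<le> 1/4\<close>: the endpoints that lose less
    than \<open>r\<close> in rank then have total weight at most \<open>1/4\<close>.\<close>
  define r where "r = nat \<lceil>1 / (8 * M)\<rceil>"
  have M0: "0 < M" using d M(1) by simp
  have r_ge: "1 / (8 * M) \<le> real r"
    unfolding r_def by linarith
  moreover have "0 < 1 / (8 * M)" using M0 by simp
  ultimately have r0: "0 < real r" by linarith
  have "real r \<le> 1 / (8 * M) + 1"
    unfolding r_def using M0 by (simp add: ceiling_correct)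
  then have "real r * M \<le> (1 / (8 * M) + 1) * M"
    using M0 by (intro mult_right_mono) auto
  also have "\<dots> = 1/8 + M"
    using M0 by (simp add: field_simps)
  finally have rM: "real r * M \<le> 1/4" using M(2) by linarith
  let ?m = "\<Sum>S\<in>Pow {..<d}. path_weight X t S" and ?B = "\<Sum>j<t. avg_iter j low_ind X"
  let ?drop = "real (rank X) - avg_iter t (\<lambda>Y. real (rank Y)) X"
  have "real t * (4 * real t / real d) \<le> 1/4"
  proof -
    have "16 * (real t)\<^sup>2 \<le> real d"
      using of_nat_mono[where 'a = real, OF d(2)] by simp
    then show ?thesis using d(1) by (simp add: field_simps power2_eq_square)
  qed
  then have m: "3/4 - ?B \<le> ?m"
    using path_weight_mass[OF d(1) X, of t t] by simp
  have "real r * (1/2 - ?B) \<le> real r * (?m - real r * M)"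
    using m rM by (intro mult_left_mono) auto
  also have "\<dots> \<le> ?drop"
    using X path_weight_le[OF d(1) X] M(1) by (intro rank_drop) auto
  finally have "1/2 - ?B \<le> ?drop / real r"
    using r0 by (simp add: pos_le_divide_eq mult.commute)
  also have "\<dots> \<le> 8 * M * ?drop"
  proof -
    have "avg (\<lambda>Y. real (rank Y)) Y \<le> real (rank Y)" if "Y \<subseteq> {..<d}" for Y
      using rank_decreasing[OF that] by (intro avg_le_const) (auto intro: less_imp_le)
    then have "0 \<le> ?drop"
      using avg_iter_le[of "\<lambda>Y. real (rank Y)" X t] X by simp
    moreover have "1 / real r \<le> 8 * M"
      using r_ge r0 M0 by (simp add: field_simps)
    ultimately show ?thesis using mult_right_mono[of "1 / real r" "8 * M" ?drop] by simp
  qed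
  finally show ?thesis by linarith
qed

text \<open>
  Summing both potentials over the next \<open>t\<close> steps turns the drop in one step into the drop over \<open>t\<close>
  steps, by telescoping.
\<close>

lemma supersolution_large_dimension:
  assumes d: "1 \<le> d" "16 * t\<^sup>2 \<le> d" and M: "M = fact t * (4 / real d) ^ t" "8 * M \<le> 1"
  obtains U where
    "\<And>X. X \<subseteq> {..<d} \<Longrightarrow> 0 \<le> U X"
    "\<And>X. X \<subseteq> {..<d} \<Longrightarrow> 1 + avg U X \<le> U X"
    "\<And>X. X \<subseteq> {..<d} \<Longrightarrow> U X \<le> 16 * real t * M * 2 ^ d + 2 * real t * real (card low_vertices)"
proof -
  let ?R = "\<lambda>Y. real (rank Y)"
  define U where "U X = 16 * M * (\<Sum>j<t. avg_iter j ?R X) + 2 * (\<Sum>j<t. avg_iter j low_below X)" for X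
  have M0: "0 < M" using d M(1) by simp
  show ?thesis
  proof (rule that[of U])
    fix X assume X: "X \<subseteq> {..<d}"
    have low_nonneg: "0 \<le> low_below Y" for Y by (simp add: low_below_def)
    show "0 \<le> U X"
      unfolding U_def using X low_nonneg M0
      by (intro add_nonneg_nonneg mult_nonneg_nonneg sum_nonneg avg_iter_nonneg) auto
    have R: "(\<Sum>j<t. avg_iter j ?R X) \<le> real t * 2 ^ d"
    proof -
      have "avg_iter j ?R X \<le> 2 ^ d" for j
      proof (rule avg_iter_le_const[OF _ _ X])
        fix Y assume "Y \<subseteq> {..<d}"
        then have "real (rank Y) < real (2 ^ d)" using rank_bound of_nat_less_iff by blast
        then show "real (rank Y) \<le> 2 ^ d" by simp
      qed simp
      then show ?thesis using sum_bounded_above[of "{..<t}" "\<lambda>j. avg_iter j ?R X" "2 ^ d"] by simp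
    qed
    have L: "(\<Sum>j<t. avg_iter j low_below X) \<le> real t * real (card low_vertices)"
    proof -
      have "avg_iter j low_below X \<le> real (card low_vertices)" for j
        using low_below_le X by (intro avg_iter_le_const) auto
      then show ?thesis
        using sum_bounded_above[of "{..<t}" "\<lambda>j. avg_iter j low_below X" "real (card low_vertices)"] by simp
    qed
    have "16 * M * (\<Sum>j<t. avg_iter j ?R X) \<le> 16 * M * (real t * 2 ^ d)"
      using R M0 by (intro mult_left_mono) auto
    then show "U X \<le> 16 * real t * M * 2 ^ d + 2 * real t * real (card low_vertices)"
      unfolding U_def using L by (simp add: algebra_simps)
    have avg_U: "avg U X = 16 * M * (\<Sum>j<t. avg_iter (Suc j) ?R X)
        + 2 * (\<Sum>j<t. avg_iter (Suc j) low_below X)"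
      unfolding U_def avg_add avg_scale avg_sum by simp
    have "avg_iter j low_ind X \<le> avg_iter j low_below X - avg_iter (Suc j) low_below X" for j
      using avg_iter_mono[of low_ind "\<lambda>Y. low_below Y - avg low_below Y" X j, OF low_below_drop X]
        avg_iter_diff[of j low_below "avg low_below" X]
      by (simp add: funpow_swap1)
    then have low: "(\<Sum>j<t. avg_iter j low_ind X)
        \<le> (\<Sum>j<t. avg_iter j low_below X) - (\<Sum>j<t. avg_iter (Suc j) low_below X)"
      unfolding sum_subtractf[symmetric] by (intro sum_mono)
    have tele: "(\<Sum>j<t. avg_iter j ?R X) - (\<Sum>j<t. avg_iter (Suc j) ?R X) = ?R X - avg_iter t ?R X"
      using sum_lessThan_telescope'[of "\<lambda>j. avg_iter j ?R X" t] by (simp add: sum_subtractf)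
    have "1 \<le> 16 * M * (?R X - avg_iter t ?R X) + 2 * (\<Sum>j<t. avg_iter j low_ind X)"
      by (rule rank_drop_or_low[OF X d M])
    also have "\<dots> \<le> U X - avg U X"
      unfolding tele[symmetric] avg_U U_def right_diff_distrib using low by simp
    finally show "1 + avg U X \<le> U X" by simp
  qed
qed

text \<open>The trivial bound \<open>2 ^ d\<close>, which serves for the finitely many small dimensions.\<close>

lemma supersolution_rank:
  assumes "X \<subseteq> {..<d}"
  shows "1 + avg (\<lambda>Y. real (rank Y) + 1) X \<le> real (rank X) + 1"
proof -
  have "avg (\<lambda>Y. real (rank Y) + 1) X \<le> real (rank X)"
    using rank_decreasing[OF assms] by (intro avg_le_const) fastforce+
  then show ?thesis by simp
qed

end

lemma eventually_dimension_large:
  fixes t :: nat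
  shows "eventually (\<lambda>d. 1 \<le> d \<and> 16 * t\<^sup>2 \<le> d \<and> (t = 0 \<or> 8 * (fact t * (4 / real d) ^ t) \<le> 1) \<and>
    (3 / (2 * 2 powr (3/4))) ^ d \<le> 1 / real d ^ t) sequentially"
proof -
  let ?a = "3 / (2 * 2 powr (3/4)) :: real"
  \<comment> \<open>The fourth power is \<open>81 / 128\<close>.\<close>
  have "?a ^ 4 < 1"
    by (simp add: power_divide power_mult_distrib powr_power)
  then have a: "?a < 1"
    by (metis linorder_not_le one_le_power)
  have "(\<lambda>d. 8 * (fact t * (4 / real d) ^ t)) \<longlonglongrightarrow> 0" if "t \<noteq> 0"
  proof -
    have "(\<lambda>d. (4 / real d) ^ t) \<longlonglongrightarrow> 0 ^ t"
      by (intro tendsto_power) real_asymp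
    then have "(\<lambda>d. 8 * fact t * (4 / real d) ^ t) \<longlonglongrightarrow> 8 * fact t * 0 ^ t"
      by (intro tendsto_mult tendsto_const)
    then show ?thesis using that by (simp add: power_0_left mult.assoc)
  qed
  then have "eventually (\<lambda>d. 8 * (fact t * (4 / real d) ^ t) < 1) sequentially" if "t \<noteq> 0"
    using that by (intro order_tendstoD(2)[where y = 0]) auto
  then have "eventually (\<lambda>d. t = 0 \<or> 8 * (fact t * (4 / real d) ^ t) \<le> 1) sequentially"
    by (cases "t = 0") (auto elim: eventually_mono)
  moreover have "eventually (\<lambda>d. ?a ^ d \<le> 1 / real d ^ t) sequentially"
  proof -
    have "(\<lambda>d. real d ^ t * ?a ^ d) \<longlonglongrightarrow> 0"
      using a by real_asymp
    then have "eventually (\<lambda>d. real d ^ t * ?a ^ d < 1) sequentially"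
      by (rule order_tendstoD(2)) simp
    then show ?thesis
      using eventually_gt_at_top[of 0]
      by eventually_elim (simp add: field_simps)
  qed
  ultimately show ?thesis
    using eventually_ge_at_top[of 1] eventually_ge_at_top[of "16 * t\<^sup>2"]
    by eventually_elim auto
qed

lemma supersolution_exists:
  fixes t :: nat
  obtains C :: real where
    "\<And>d out rank. 1 \<le> d \<Longrightarrow> cube_auso d out rank \<Longrightarrow>
       \<exists>U. \<forall>X\<subseteq>{..<d}. 0 \<le> U X \<and> 1 + cube_auso.avg out U X \<le> U X \<and> U X \<le> C * (2 ^ d / real d ^ t)"
proof -
  obtain d0 where d0: "\<And>d. d0 \<le> d \<Longrightarrow> 1 \<le> d \<and> 16 * t\<^sup>2 \<le> d \<and>
      (t = 0 \<or> 8 * (fact t * (4 / real d) ^ t) \<le> 1) \<and> (3 / (2 * 2 powr (3/4))) ^ d \<le> 1 / real d ^ t"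
    using eventually_dimension_large[of t] unfolding eventually_sequentially by blast
  define C :: real where "C = max (real d0 ^ t) (16 * real t * fact t * 4 ^ t + 2 * real t)"
  show ?thesis
  proof (rule that[of C])
    fix d out rank assume d: "1 \<le> d" and "cube_auso d out rank"
    then interpret cube_auso d out rank by simp
    show "\<exists>U. \<forall>X\<subseteq>{..<d}. 0 \<le> U X \<and> 1 + avg U X \<le> U X \<and> U X \<le> C * (2 ^ d / real d ^ t)"
    proof (cases "t = 0 \<or> d < d0")
      case True
      then have "real d ^ t \<le> real d0 ^ t" by (auto intro: power_mono)
      also have "\<dots> \<le> C" by (simp add: C_def)
      finally have "real d ^ t * (2 ^ d / real d ^ t) \<le> C * (2 ^ d / real d ^ t)"
        by (intro mult_right_mono) auto
      then have C: "2 ^ d \<le> C * (2 ^ d / real d ^ t)" using d by simp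
      have "real (rank X) + 1 \<le> C * (2 ^ d / real d ^ t)" if "X \<subseteq> {..<d}" for X
      proof -
        have "rank X + 1 \<le> 2 ^ d" using rank_bound[OF that] by simp
        then have "real (rank X + 1) \<le> real (2 ^ d)" by (rule of_nat_mono)
        then show ?thesis using C by simp
      qed
      then show ?thesis
        using supersolution_rank by (intro exI[of _ "\<lambda>X. real (rank X) + 1"]) auto
    next
      case False
      define M :: real where "M = fact t * (4 / real d) ^ t"
      have large: "16 * t\<^sup>2 \<le> d" "8 * M \<le> 1" and a: "(3 / (2 * 2 powr (3/4))) ^ d \<le> 1 / real d ^ t"
        using d0[of d] False by (auto simp: M_def)
      have "real (card low_vertices) \<le> 2 ^ d * (1 / real d ^ t)"
        using card_low_vertices_le by (rule order_trans) (intro mult_left_mono a, simp)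
      then have "2 * real t * real (card low_vertices) \<le> 2 * real t * (2 ^ d * (1 / real d ^ t))"
        by (intro mult_left_mono) auto
      then have "16 * real t * M * 2 ^ d + 2 * real t * real (card low_vertices)
          \<le> (16 * real t * fact t * 4 ^ t + 2 * real t) * (2 ^ d / real d ^ t)"
        by (simp add: M_def power_divide algebra_simps)
      also have "\<dots> \<le> C * (2 ^ d / real d ^ t)"
        by (intro mult_right_mono) (auto simp: C_def)
      finally have C: "16 * real t * M * 2 ^ d + 2 * real t * real (card low_vertices)
          \<le> C * (2 ^ d / real d ^ t)" .
      obtain U where "\<And>X. X \<subseteq> {..<d} \<Longrightarrow> 0 \<le> U X" "\<And>X. X \<subseteq> {..<d} \<Longrightarrow> 1 + avg U X \<le> U X"
        "\<And>X. X \<subseteq> {..<d} \<Longrightarrow> U X \<le> 16 * real t * M * 2 ^ d + 2 * real t * real (card low_vertices)"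
        using supersolution_large_dimension[OF d large(1) M_def large(2)] by metis
      then show ?thesis using C by (intro exI[of _ U]) (meson order_trans)
    qed
  qed
qed


section \<open>Random-Edge on combinatorial cubes\<close>

text \<open>
  By induction along the arcs, since the expected number of visits satisfies the defining
  inequality of \<open>U\<close> with equality.
\<close>

lemma expected_visited_le_supersolution:
  assumes "finite A" "acyclic A"
    and closed: "\<And>v. v \<in> V \<Longrightarrow> A `` {v} \<subseteq> V"
    and nonneg: "\<And>v. v \<in> V \<Longrightarrow> 0 \<le> U v"
    and super: "\<And>v. v \<in> V \<Longrightarrow> 1 + (\<Sum>w\<in>A `` {v}. U w) / real (card (A `` {v})) \<le> U v"
    and "v \<in> V"
  shows "expected_visited A v \<le> ennreal (U v)"
  using \<open>v \<in> V\<close>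
proof (induction v rule: wf_induct_rule[OF finite_acyclic_wf_converse[OF assms(1,2)]])
  case (1 v)
  let ?O = "A `` {v}"
  have fin: "finite ?O" using assms(1) by (rule finite_Image)
  show ?case
  proof (cases "?O = {}")
    case True
    then have "expected_visited A v = 1"
      by (simp add: expected_visited_def random_edge.simps[of A v] nn_integral_return
          measure_spmf_return_spmf)
    also have "\<dots> \<le> ennreal (U v)"
      using super[OF "1.prems"] True by (simp flip: ennreal_1)
    finally show ?thesis .
  next
    case False
    have IH: "expected_visited A w \<le> ennreal (U w)" if "w \<in> ?O" for w
      using 1 that closed by blast
    have U0: "0 \<le> U w" if "w \<in> ?O" for w
      using nonneg closed[OF "1.prems"] that by blast
    have step: "(\<integral>\<^sup>+p. of_nat (length p) \<partial>measure_spmf (map_spmf ((#) v) (random_edge A w)))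
        \<le> 1 + expected_visited A w" for w
    proof -
      have "(\<integral>\<^sup>+p. of_nat (length p) \<partial>measure_spmf (map_spmf ((#) v) (random_edge A w)))
          = (\<integral>\<^sup>+p. 1 + of_nat (length p) \<partial>measure_spmf (random_edge A w))"
        by (simp add: measure_map_spmf_conv_distr nn_integral_distr)
      also have "\<dots> = emeasure (measure_spmf (random_edge A w)) (space (measure_spmf (random_edge A w)))
          + expected_visited A w"
        by (simp add: nn_integral_add expected_visited_def del: space_measure_spmf)
      also have "\<dots> \<le> 1 + expected_visited A w"
        by (intro add_right_mono measure_spmf.subprob_emeasure_le_1)
      finally show ?thesis .
    qed
    have "expected_visited A v =
        (\<integral>\<^sup>+w. (\<integral>\<^sup>+p. of_nat (length p) \<partial>measure_spmf (map_spmf ((#) v) (random_edge A w)))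
           \<partial>measure_spmf (spmf_of_set ?O))"
      unfolding expected_visited_def random_edge.simps[of A v] using False
      by (simp add: measure_spmf_bind nn_integral_bind[where B="count_space UNIV"] o_def)
    also have "\<dots> \<le> (\<integral>\<^sup>+w. 1 + expected_visited A w \<partial>measure_spmf (spmf_of_set ?O))"
      by (intro nn_integral_mono step)
    also have "\<dots> = (\<Sum>w\<in>?O. 1 + expected_visited A w) / ennreal (card ?O)"
      by (simp add: nn_integral_spmf_of_set ennreal_of_nat_eq_real_of_nat)
    also have "\<dots> \<le> (\<Sum>w\<in>?O. ennreal (1 + U w)) / ennreal (card ?O)"
    proof (intro divide_right_mono_ennreal sum_mono)
      fix w assume "w \<in> ?O"
      then show "1 + expected_visited A w \<le> ennreal (1 + U w)"
        using IH U0 by (simp add: ennreal_plus)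
    qed
    also have "\<dots> = ennreal ((\<Sum>w\<in>?O. 1 + U w) / real (card ?O))"
    proof -
      have "(\<Sum>w\<in>?O. ennreal (1 + U w)) = ennreal (\<Sum>w\<in>?O. 1 + U w)"
        using U0 by (intro sum_ennreal) force
      then show ?thesis
        using U0 False fin by (auto simp: divide_ennreal card_gt_0_iff intro!: divide_ennreal sum_nonneg add_nonneg_nonneg)
    qed
    also have "(\<Sum>w\<in>?O. 1 + U w) / real (card ?O) = 1 + (\<Sum>w\<in>?O. U w) / real (card ?O)"
      using False fin by (simp add: sum.distrib add_divide_distrib card_gt_0_iff)
    also have "ennreal \<dots> \<le> ennreal (U v)"
      using super[OF "1.prems"] by (rule ennreal_leI)
    finally show ?thesis .
  qed
qed

text \<open>An objective function may take equal values at nonadjacent vertices; ties are broken here.\<close>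

lemma exists_injective_rank:
  fixes \<phi> :: "'a \<Rightarrow> real"
  assumes "finite V"
  obtains \<rho> :: "'a \<Rightarrow> nat" where "inj_on \<rho> V" "\<And>v. v \<in> V \<Longrightarrow> \<rho> v < card V"
    "\<And>v w. v \<in> V \<Longrightarrow> w \<in> V \<Longrightarrow> \<phi> w < \<phi> v \<Longrightarrow> \<rho> w < \<rho> v"
proof -
  have "\<exists>\<rho>::'a \<Rightarrow> nat. inj_on \<rho> V \<and> (\<forall>v\<in>V. \<rho> v < card V) \<and>
      (\<forall>v\<in>V. \<forall>w\<in>V. \<phi> w < \<phi> v \<longrightarrow> \<rho> w < \<rho> v)"
    using assms
  proof (induction rule: finite_ranking_induct[where f = \<phi>])
    case (insert x S)
    then obtain \<rho> :: "'a \<Rightarrow> nat" where \<rho>: "inj_on \<rho> S" "\<forall>v\<in>S. \<rho> v < card S"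
      "\<forall>v\<in>S. \<forall>w\<in>S. \<phi> w < \<phi> v \<longrightarrow> \<rho> w < \<rho> v" by blast
    show ?case
    proof (cases "x \<in> S")
      case True
      then show ?thesis using \<rho> by (auto simp: insert_absorb)
    next
      case False
      let ?\<rho> = "\<rho>(x := card S)"
      have "inj_on ?\<rho> (insert x S)"
      proof (subst inj_on_insert, intro conjI)
        show "inj_on ?\<rho> S" using \<rho>(1) False by (simp add: inj_on_fun_updI inj_on_def)
        have "?\<rho> y < ?\<rho> x" if "y \<in> S - {x}" for y using that \<rho>(2) by simp
        then show "?\<rho> x \<notin> ?\<rho> ` (S - {x})" by (metis imageE less_irrefl)
      qed
      moreover have "\<forall>v\<in>insert x S. ?\<rho> v < card (insert x S)"
        using \<rho>(2) False insert.hyps(1) by (auto simp: less_Suc_eq)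
      moreover have "\<forall>v\<in>insert x S. \<forall>w\<in>insert x S. \<phi> w < \<phi> v \<longrightarrow> ?\<rho> w < ?\<rho> v"
      proof (intro ballI impI)
        fix v w assume v: "v \<in> insert x S" and w: "w \<in> insert x S" and less: "\<phi> w < \<phi> v"
        have "w \<noteq> x" using v less insert.hyps(2) by force
        then show "?\<rho> w < ?\<rho> v" using v w less \<rho>(2,3) by (cases "v = x") auto
      qed
      ultimately show ?thesis by blast
    qed
  qed simp
  then show ?thesis using that by blast
qed

text \<open>
  For \<open>unique_sink\<close>, a vertex without outgoing directions in \<open>S\<close> is a sink of the face spanned by the
  interval from \<open>X - S\<close> to \<open>X \<union> S\<close>, in which all edges have their direction in \<open>S\<close>.
\<close>

lemma cube_auso_of_objective_function:
  assumes A: "A = induced_orientation P \<phi>" and auso: "AUSO P A"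
    and v: "bij_betw v (Pow {..<d}) (vertices P)"
    and adj: "\<And>X Y. X \<subseteq> {..<d} \<Longrightarrow> Y \<subseteq> {..<d} \<Longrightarrow>
       adjacent P (v X) (v Y) \<longleftrightarrow> (\<exists>i<d. Y = flip X {i})"
    and face: "\<And>I J. I \<subseteq> {..<d} \<Longrightarrow>
       \<exists>F. F face_of P \<and> vertices F = v ` {X. X \<subseteq> {..<d} \<and> I \<subseteq> X \<and> X \<subseteq> J}"
  shows "\<exists>rank. cube_auso d (\<lambda>X. {i. i < d \<and> (v X, v (flip X {i})) \<in> A}) rank"
proof -
  let ?D = "{..<d}" and ?out = "\<lambda>X. {i. i < d \<and> (v X, v (flip X {i})) \<in> A}"
  have v_in: "v X \<in> vertices P" if "X \<subseteq> ?D" for X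
    using v that by (auto simp: bij_betw_def)
  have v_inj: "X = Y" if "v X = v Y" "X \<subseteq> ?D" "Y \<subseteq> ?D" for X Y
    using v that by (auto simp: bij_betw_def inj_on_def)
  have finV: "finite (vertices P)" and cardV: "card (vertices P) = 2 ^ d"
    using bij_betw_finite[OF v] bij_betw_same_card[OF v] by (simp_all add: card_Pow)
  obtain \<rho> :: "_ \<Rightarrow> nat" where \<rho>: "inj_on \<rho> (vertices P)" "\<And>x. x \<in> vertices P \<Longrightarrow> \<rho> x < card (vertices P)"
    "\<And>x y. x \<in> vertices P \<Longrightarrow> y \<in> vertices P \<Longrightarrow> \<phi> y < \<phi> x \<Longrightarrow> \<rho> y < \<rho> x"
    using exists_injective_rank[OF finV, of \<phi>] by metis
  have "cube_auso d ?out (\<rho> \<circ> v)"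
  proof
    fix X assume X: "X \<subseteq> ?D"
    show "?out X \<subseteq> ?D" by auto
    show "(\<rho> \<circ> v) X < 2 ^ d"
      using \<rho>(2)[OF v_in[OF X]] cardV by simp
    fix i assume i: "i \<in> ?out X"
    then have "flip X {i} \<subseteq> ?D" using X by (intro flip_subset) auto
    then show "(\<rho> \<circ> v) (flip X {i}) < (\<rho> \<circ> v) X"
      using \<rho>(3)[OF v_in[OF X] v_in[of "flip X {i}"]] i by (simp add: A induced_orientation_def)
  next
    show "inj_on (\<rho> \<circ> v) (Pow ?D)"
      using v \<rho>(1) by (intro comp_inj_on) (auto simp: bij_betw_def)
  next
    fix X Y S assume X: "X \<subseteq> ?D" and Y: "Y \<subseteq> ?D" and eq: "X - S = Y - S"
      and sinks: "?out X \<inter> S = {}" "?out Y \<inter> S = {}"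
    obtain F where F: "F face_of P" "vertices F = v ` {Z. Z \<subseteq> ?D \<and> X - S \<subseteq> Z \<and> Z \<subseteq> X \<union> S}"
      using face[of "X - S" "X \<union> S"] X by blast
    have sink: "is_sink_on A (vertices F) (v Z)"
      if Z: "Z \<subseteq> ?D" "Z - S = X - S" "?out Z \<inter> S = {}" for Z
      unfolding is_sink_on_def
    proof (intro conjI ballI notI)
      show "v Z \<in> vertices F" unfolding F(2) using Z by (intro imageI) blast
      fix w assume "w \<in> vertices F" and arc: "(v Z, w) \<in> A"
      then obtain W where W: "W \<subseteq> ?D" "X - S \<subseteq> W" "W \<subseteq> X \<union> S" "w = v W" unfolding F(2) by blast
      have "adjacent P (v Z) (v W)" using arc W(4) by (simp add: A induced_orientation_def)
      then obtain i where i: "i < d" "W = flip Z {i}" using adj[OF Z(1) W(1)] by blast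
      have "i \<notin> S" using Z(3) i arc W(4) by blast
      then have "i \<in> Z \<longleftrightarrow> i \<in> X" using Z(2) by blast
      moreover have "i \<in> W \<longleftrightarrow> i \<notin> Z" using i(2) by simp
      ultimately show False using W(2,3) \<open>i \<notin> S\<close> by blast
    qed
    have "F \<noteq> {}"
      using sink[OF X refl sinks(1)] vertices_subset[of F] by (auto simp: is_sink_on_def)
    then have "\<exists>!x. is_sink_on A (vertices F) x"
      using auso F(1) by (auto simp: AUSO_def)
    then have "v X = v Y"
      using sink[OF X refl sinks(1)] sink[OF Y eq[symmetric] sinks(2)] by blast
    then show "X = Y" using v_inj X Y by blast
  qed
  then show ?thesis by blast
qed

theorem theorem2:
  fixes t :: nat
  shows "\<exists>C::real. \<forall>d\<ge>1. \<forall>(P :: (nat \<Rightarrow>\<^sub>0 real) set) \<phi> s.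
           combinatorial_cube d P \<longrightarrow>
           abstract_objective_function P \<phi> \<longrightarrow>
           s \<in> vertices P \<longrightarrow>
           expected_visited (induced_orientation P \<phi>) s \<le> ennreal (C * (2 ^ d / real d ^ t))"
proof -
  obtain C :: real where C: "\<And>d out rank. 1 \<le> d \<Longrightarrow> cube_auso d out rank \<Longrightarrow>
       \<exists>U. \<forall>X\<subseteq>{..<d}. 0 \<le> U X \<and> 1 + cube_auso.avg out U X \<le> U X \<and> U X \<le> C * (2 ^ d / real d ^ t)"
    using supersolution_exists[of t] by metis
  have "expected_visited (induced_orientation P \<phi>) s \<le> ennreal (C * (2 ^ d / real d ^ t))"
    if d: "1 \<le> d" and cube: "combinatorial_cube d P" and obj: "abstract_objective_function P \<phi>"
      and s: "s \<in> vertices P" for d and P :: "(nat \<Rightarrow>\<^sub>0 real) set" and \<phi> s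
  proof -
    define A where "A = induced_orientation P \<phi>"
    have auso: "AUSO P A" using obj by (simp add: abstract_objective_function_def A_def)
    obtain v where v: "bij_betw v (Pow {..<d}) (vertices P)"
      and adj: "\<And>X Y. X \<subseteq> {..<d} \<Longrightarrow> Y \<subseteq> {..<d} \<Longrightarrow>
         adjacent P (v X) (v Y) \<longleftrightarrow> (\<exists>i<d. Y = flip X {i})"
      and face: "\<And>I J. I \<subseteq> {..<d} \<Longrightarrow>
         \<exists>F. F face_of P \<and> vertices F = v ` {X. X \<subseteq> {..<d} \<and> I \<subseteq> X \<and> X \<subseteq> J}"
      by (rule combinatorial_cube_coordinates[OF cube], rule that)
    define out where "out X = {i. i < d \<and> (v X, v (flip X {i})) \<in> A}" for X
    obtain rank where auso': "cube_auso d out rank"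
      using cube_auso_of_objective_function[OF A_def auso v adj face] unfolding out_def by blast
    then interpret cube_auso d out rank .
    obtain U where U: "\<And>X. X \<subseteq> {..<d} \<Longrightarrow> 0 \<le> U X" "\<And>X. X \<subseteq> {..<d} \<Longrightarrow> 1 + avg U X \<le> U X"
      "\<And>X. X \<subseteq> {..<d} \<Longrightarrow> U X \<le> C * (2 ^ d / real d ^ t)"
      using C[OF d auso'] by metis
    define \<pi> where "\<pi> = the_inv_into (Pow {..<d}) v"
    have \<pi>v: "\<pi> (v X) = X" if "X \<subseteq> {..<d}" for X
      using v that by (simp add: \<pi>_def the_inv_into_f_f bij_betw_def)
    have surj: "\<exists>X\<subseteq>{..<d}. v X = x" if "x \<in> vertices P" for x
    proof -
      have "x \<in> v ` Pow {..<d}" using bij_betw_imp_surj_on[OF v] that by simp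
      then show ?thesis by auto
    qed
    have A_vertices: "A \<subseteq> vertices P \<times> vertices P"
      by (auto simp: A_def induced_orientation_def adjacent_def)
    have out_image: "A `` {v X} = (\<lambda>i. v (flip X {i})) ` out X" if X: "X \<subseteq> {..<d}" for X
    proof
      show "A `` {v X} \<subseteq> (\<lambda>i. v (flip X {i})) ` out X"
      proof
        fix w assume w: "w \<in> A `` {v X}"
        then have "w \<in> vertices P" using A_vertices by blast
        then obtain Y where Y: "Y \<subseteq> {..<d}" "v Y = w" using surj by blast
        have "adjacent P (v X) (v Y)"
          using w Y(2) by (auto simp: A_def induced_orientation_def)
        then obtain i where "i < d" "Y = flip X {i}" using adj[OF X Y(1)] by blast
        then show "w \<in> (\<lambda>i. v (flip X {i})) ` out X"
          using w Y(2) by (auto simp: out_def)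
      qed
    qed (auto simp: out_def)
    have inj: "inj_on (\<lambda>i. v (flip X {i})) (out X)" if X: "X \<subseteq> {..<d}" for X
    proof (rule inj_onI)
      fix i j assume ij: "i \<in> out X" "j \<in> out X" and eq: "v (flip X {i}) = v (flip X {j})"
      have "flip X {i} = flip X {j}"
        by (rule inj_onD[OF bij_betw_imp_inj_on[OF v] eq]) (intro PowI step_in_cube X ij)+
      then have "flip X (flip X {i}) = flip X (flip X {j})" by (rule arg_cong)
      then show "i = j" by simp
    qed
    have "expected_visited A s \<le> ennreal (U (\<pi> s))"
    proof (rule expected_visited_le_supersolution[where V = "vertices P" and U = "\<lambda>x. U (\<pi> x)"])
      have "polytope P" using cube by (simp add: combinatorial_cube_def)
      then show "finite A" using finite_subset[OF A_vertices] finite_vertices by blast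
      show "acyclic A" using auso by (simp add: AUSO_def)
      show "s \<in> vertices P" by (fact s)
      fix x assume "x \<in> vertices P"
      then obtain X where X: "X \<subseteq> {..<d}" "v X = x" using surj by blast
      show "A `` {x} \<subseteq> vertices P" using A_vertices by blast
      show "0 \<le> U (\<pi> x)" using U(1) X \<pi>v by auto
      have "(\<Sum>w\<in>A `` {x}. U (\<pi> w)) = (\<Sum>i\<in>out X. U (flip X {i}))"
        using \<pi>v step_in_cube[OF X(1)]
        by (simp add: out_image[OF X(1)] sum.reindex[OF inj[OF X(1)]] flip: X(2))
      moreover have "card (A `` {x}) = card (out X)"
        by (simp add: out_image[OF X(1)] card_image[OF inj[OF X(1)]] flip: X(2))
      ultimately show "1 + (\<Sum>w\<in>A `` {x}. U (\<pi> w)) / real (card (A `` {x})) \<le> U (\<pi> x)"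
        using U(2)[OF X(1)] \<pi>v[OF X(1)] X(2) by (simp add: avg_def)
    qed
    also have "\<dots> \<le> ennreal (C * (2 ^ d / real d ^ t))"
      using U(3) surj[OF s] \<pi>v by (intro ennreal_leI) auto
    finally show ?thesis by (simp add: A_def)
  qed
  then show ?thesis by blast
qed

end
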